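(* For every $n\ge 1$ and every set $S\subseteq\mathbb{R}^n$: $S$ is semi-polinear if and only if $S$ is mixed-linear (i.e. definable in the mixed additive theory $\mathrm{FO}(\mathbb{R},\mathbb{Z},+,\leq)$).
   Context: The mixed additive theory $\mathrm{FO}(\mathbb{R},\mathbb{Z},+,\leq)$ is the first-order logic over the real numbers with addition, the order $\leq$, and a unary predicate for membership in $\mathbb{Z}$ (equivalently, with quantification over both reals and integers). A set $S\subseteq\mathbb{R}^n$ is mixed-linear if it is the set of tuples satisfying some formula of this logic (without parameters) with $n$ free variables. A polyhedral convex set of $\mathbb{R}^n$ is a set of the form $C=\{c\in\mathbb{R}^n\mid \forall j\in\{1,\dots,k\}\ \sum_{i=1}^n\alpha_j[i]\,c[i]\ \#_j\ \beta_j\}$ for some finite (possibly empty) sequence of tuples $(\alpha_j,\#_j,\beta_j)\in\mathbb{Q}^n\times\{<,\leq,=,\geq,>\}\times\mathbb{Q}$. A finitely generated monoid is a subset $M\subseteq\mathbb{Z}^n$ such that $M=P^*$ for some finite $P\subseteq\mathbb{Z}^n$, where $P^*=\{0\}\cup\{p_1+\cdots+p_k\mid k\ge 1,\ p_i\in P\}$. A polinear set is a subset $L\subseteq\mathbb{R}^n$ of the form $L=C+b+M=\{c+z\mid c\in C,\ z\in b+M\}$, where $b\in\mathbb{Z}^n$, $M\subseteq\mathbb{Z}^n$ is a finitely generated monoid, and $C\subseteq[0,1)^n$ is a non-empty polyhedral convex set. A semi-polinear set is a finite (possibly empty) union of polinear sets. *)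

theory Defs
  imports Complex_Main "Jordan_Normal_Form.Matrix"
begin

text \<open>
  Points of \<open>\<real>\<^sup>n\<close> are elements of \<^term>\<open>carrier_vec n :: real vec set\<close>; coordinates are
  numbered from \<open>0\<close> to \<open>n - 1\<close>.
\<close>

subsection \<open>The mixed additive theory\<close>

datatype tm = Var nat | Plus tm tm

text \<open>
  Named variables and a single sort: all quantifiers range over the reals, and \<open>IsInt\<close> is the
  predicate for membership in the integers. There are no constant symbols and no parameters.
\<close>

datatype fm =
    Equal tm tm
  | Leq tm tm
  | IsInt tm
  | Neg fm
  | Conj fm fm
  | Disj fm fm
  | Impl fm fm
  | Exists nat fm
  | Forall nat fm

primrec tm_val :: "(nat \<Rightarrow> real) \<Rightarrow> tm \<Rightarrow> real" where
  "tm_val e (Var v) = e v"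
| "tm_val e (Plus s t) = tm_val e s + tm_val e t"

primrec sat :: "(nat \<Rightarrow> real) \<Rightarrow> fm \<Rightarrow> bool" where
  "sat e (Equal s t) \<longleftrightarrow> tm_val e s = tm_val e t"
| "sat e (Leq s t) \<longleftrightarrow> tm_val e s \<le> tm_val e t"
| "sat e (IsInt t) \<longleftrightarrow> tm_val e t \<in> \<int>"
| "sat e (Neg \<phi>) \<longleftrightarrow> \<not> sat e \<phi>"
| "sat e (Conj \<phi> \<psi>) \<longleftrightarrow> sat e \<phi> \<and> sat e \<psi>"
| "sat e (Disj \<phi> \<psi>) \<longleftrightarrow> sat e \<phi> \<or> sat e \<psi>"
| "sat e (Impl \<phi> \<psi>) \<longleftrightarrow> (sat e \<phi> \<longrightarrow> sat e \<psi>)"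
| "sat e (Exists v \<phi>) \<longleftrightarrow> (\<exists>r. sat (e(v := r)) \<phi>)"
| "sat e (Forall v \<phi>) \<longleftrightarrow> (\<forall>r. sat (e(v := r)) \<phi>)"

primrec tm_vars :: "tm \<Rightarrow> nat set" where
  "tm_vars (Var v) = {v}"
| "tm_vars (Plus s t) = tm_vars s \<union> tm_vars t"

primrec free_vars :: "fm \<Rightarrow> nat set" where
  "free_vars (Equal s t) = tm_vars s \<union> tm_vars t"
| "free_vars (Leq s t) = tm_vars s \<union> tm_vars t"
| "free_vars (IsInt t) = tm_vars t"
| "free_vars (Neg \<phi>) = free_vars \<phi>"
| "free_vars (Conj \<phi> \<psi>) = free_vars \<phi> \<union> free_vars \<psi>"
| "free_vars (Disj \<phi> \<psi>) = free_vars \<phi> \<union> free_vars \<psi>"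
| "free_vars (Impl \<phi> \<psi>) = free_vars \<phi> \<union> free_vars \<psi>"
| "free_vars (Exists v \<phi>) = free_vars \<phi> - {v}"
| "free_vars (Forall v \<phi>) = free_vars \<phi> - {v}"

text \<open>
  Variable \<open>i < n\<close> denotes coordinate \<open>i\<close>. The value of \<open>x $ i\<close> for \<open>i \<ge> n\<close> is irrelevant,
  because no such variable occurs free in the formula.
\<close>

definition mixed_linear :: "nat \<Rightarrow> real vec set \<Rightarrow> bool" where
  "mixed_linear n S \<longleftrightarrow>
    (\<exists>\<phi>. free_vars \<phi> \<subseteq> {..<n} \<and> S = {x \<in> carrier_vec n. sat (\<lambda>i. x $ i) \<phi>})"

subsection \<open>Semi-polinear sets\<close>

datatype cmp = LT | LE | EQ | GE | GT

primrec cmp_rel :: "cmp \<Rightarrow> real \<Rightarrow> real \<Rightarrow> bool" where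
  "cmp_rel LT x y \<longleftrightarrow> x < y"
| "cmp_rel LE x y \<longleftrightarrow> x \<le> y"
| "cmp_rel EQ x y \<longleftrightarrow> x = y"
| "cmp_rel GE x y \<longleftrightarrow> x \<ge> y"
| "cmp_rel GT x y \<longleftrightarrow> x > y"

definition polyhedral_convex :: "nat \<Rightarrow> real vec set \<Rightarrow> bool" where
  "polyhedral_convex n C \<longleftrightarrow>
    (\<exists>cs :: (rat vec \<times> cmp \<times> rat) list.
      (\<forall>(\<alpha>, r, \<beta>) \<in> set cs. \<alpha> \<in> carrier_vec n) \<and>
      C = {c \<in> carrier_vec n. \<forall>(\<alpha>, r, \<beta>) \<in> set cs.
             cmp_rel r (\<Sum>i<n. of_rat (\<alpha> $ i) * c $ i) (of_rat \<beta>)})"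

definition int_vecs :: "nat \<Rightarrow> real vec set" where
  "int_vecs n = {x \<in> carrier_vec n. \<forall>i<n. x $ i \<in> \<int>}"

text \<open>The empty list of summands contributes the zero vector.\<close>

definition vec_star :: "nat \<Rightarrow> real vec set \<Rightarrow> real vec set" where
  "vec_star n P = {foldr (+) ps (0\<^sub>v n) | ps. set ps \<subseteq> P}"

definition fin_gen_monoid :: "nat \<Rightarrow> real vec set \<Rightarrow> bool" where
  "fin_gen_monoid n M \<longleftrightarrow> (\<exists>P. finite P \<and> P \<subseteq> int_vecs n \<and> M = vec_star n P)"

definition unit_cube :: "nat \<Rightarrow> real vec set" where
  "unit_cube n = {x \<in> carrier_vec n. \<forall>i<n. 0 \<le> x $ i \<and> x $ i < 1}"

definition polinear :: "nat \<Rightarrow> real vec set \<Rightarrow> bool" where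
  "polinear n L \<longleftrightarrow>
    (\<exists>C b M. polyhedral_convex n C \<and> C \<noteq> {} \<and> C \<subseteq> unit_cube n \<and>
      b \<in> int_vecs n \<and> fin_gen_monoid n M \<and>
      L = {c + (b + m) | c m. c \<in> C \<and> m \<in> M})"

definition semi_polinear :: "nat \<Rightarrow> real vec set \<Rightarrow> bool" where
  "semi_polinear n S \<longleftrightarrow> (\<exists>F. finite F \<and> (\<forall>L \<in> F. polinear n L) \<and> S = \<Union>F)"

end

theory Submission
  imports Defs "HOL-Decision_Procs.MIR"
begin

text \<open>
  From formulas to semi-polinear sets: the quantifier elimination of Weispfenning for linear
  arithmetic over the reals with floor (theory \<^theory>\<open>HOL-Decision_Procs.MIR\<close>) turns a formula
  into a quantifier-free one over terms with floors. Write \<open>x = \<lfloor>x\<rfloor> + frac x\<close>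
  coordinatewise. Since \<open>frac x\<close> lies in the unit cube, a linear form in it has only finitely
  many possible floors; case distinction over these makes every atom a Boolean combination of linear
  conditions on \<open>frac x\<close> and linear or divisibility conditions on \<open>\<lfloor>x\<rfloor>\<close>. In
  disjunctive normal form the former cut out polyhedral subsets of the cube, while the latter define
  semilinear sets of integer vectors by Dickson's lemma.

  From semi-polinear sets to formulas: existentially quantify over the multiplicities of the
  generators of the monoid; what remains is a system of rational linear constraints.
\<close>

text \<open>Eliminated formulas contain nested floors, so treating atoms alone is not enough: a
  class of functions closed under addition, integer scaling and floor is needed. This is
  \<open>split_fun\<close>: finitely many guarded pieces, each affine with separate integer
  coefficients on floors and on fractional parts. Closure under floor holds because an integer
  combination of floors passes through the outer floor, and what remains is bounded. Sign and
  divisibility tests are then rewritten as tests on \<open>\<lfloor>f x\<rfloor>\<close>, so the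
  single transfer lemma \<open>split_pred_floor\<close> handles all atoms.

  On the integer side, solutions are signed and an inhomogeneous system is not closed under
  subtraction. Both defects are met by choosing suitable natural-number coordinates for Dickson's
  lemma, after which the homogeneous case is a descent and the general case a translation of it.

  In the converse direction the obstacle is the poor language: it has no constants, no subtraction
  and no scalar multiplication. Zero is the solution of \<open>v + v = v\<close>, one is the least
  positive integer, and both enter as quantified variables.\<close>

definition lin :: "nat \<Rightarrow> (nat \<Rightarrow> int) \<Rightarrow> (nat \<Rightarrow> 'a::comm_ring_1) \<Rightarrow> 'a" where
  "lin n a y = (\<Sum>i<n. of_int (a i) * y i)"

lemma lin_cong: "(\<And>i. i < n \<Longrightarrow> y i = z i) \<Longrightarrow> lin n a y = lin n a z"
  by (simp add: lin_def)

lemma lin_coeff_simps: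
  "lin n (\<lambda>i. 0) y = 0"
  "lin n (\<lambda>i. a i + b i) y = lin n a y + lin n b y"
  "lin n (\<lambda>i. - a i) y = - lin n a y"
  "lin n (\<lambda>i. c * a i) y = of_int c * lin n a y"
  by (simp_all add: lin_def algebra_simps sum.distrib sum_negf sum_distrib_left)

lemma lin_arg_simps:
  "lin n a (\<lambda>i. 0) = 0"
  "lin n a (\<lambda>i. y i + z i) = lin n a y + lin n a z"
  "lin n a (\<lambda>i. y i - z i) = lin n a y - lin n a z"
  by (simp_all add: lin_def algebra_simps sum.distrib sum_subtractf)

lemma lin_unit: "m < n \<Longrightarrow> lin n (\<lambda>i. if i = m then 1 else 0) y = y m"
  by (simp add: lin_def if_distrib[of of_int] if_distrib[of "\<lambda>t. t * _"] cong: if_cong)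

text \<open>Source of all finiteness below: a fractional part lies in \<open>[0, 1)\<close>, so
  coefficient \<open>a i\<close> contributes at most \<open>\<bar>a i\<bar>\<close>.\<close>

lemma abs_lin_frac_le: "\<bar>lin n a (\<lambda>i. frac (x i :: real))\<bar> \<le> of_int (\<Sum>i<n. \<bar>a i\<bar>)"
proof -
  have "\<bar>lin n a (\<lambda>i. frac (x i))\<bar> \<le> (\<Sum>i<n. \<bar>of_int (a i) * frac (x i)\<bar>)"
    unfolding lin_def by (rule sum_abs)
  also have "\<dots> \<le> (\<Sum>i<n. of_int \<bar>a i\<bar>)"
    by (intro sum_mono) (auto simp: abs_mult frac_lt_1 less_imp_le intro: mult_left_le)
  finally show ?thesis by simp
qed

subsection \<open>Translation to the quantifier elimination procedure\<close>

primrec mir_num :: "tm \<Rightarrow> (nat \<Rightarrow> nat) \<Rightarrow> MIR.num" where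
  "mir_num (Var v) g = Bound (g v)"
| "mir_num (Plus s t) g = Add (mir_num s g) (mir_num t g)"

text \<open>The map \<open>g\<close> sends named variables to de Bruijn indices. Under a quantifier
  the bound name gets index 0 and every other index is shifted; overriding an earlier entry for the
  same name is what implements shadowing.\<close>

primrec mir_fm :: "Defs.fm \<Rightarrow> (nat \<Rightarrow> nat) \<Rightarrow> MIR.fm" where
  "mir_fm (Equal s t) g = MIR.Eq (Sub (mir_num s g) (mir_num t g))"
| "mir_fm (Leq s t) g = Le (Sub (mir_num s g) (mir_num t g))"
| "mir_fm (IsInt t) g = Dvd 1 (mir_num t g)"
| "mir_fm (Defs.Neg \<phi>) g = MIR.Not (mir_fm \<phi> g)"
| "mir_fm (Conj \<phi> \<psi>) g = And (mir_fm \<phi> g) (mir_fm \<psi> g)"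
| "mir_fm (Disj \<phi> \<psi>) g = Or (mir_fm \<phi> g) (mir_fm \<psi> g)"
| "mir_fm (Impl \<phi> \<psi>) g = Imp (mir_fm \<phi> g) (mir_fm \<psi> g)"
| "mir_fm (Exists v \<phi>) g = MIR.E (mir_fm \<phi> (\<lambda>u. if u = v then 0 else Suc (g u)))"
| "mir_fm (Forall v \<phi>) g = MIR.A (mir_fm \<phi> (\<lambda>u. if u = v then 0 else Suc (g u)))"

lemma Inum_mir_num: "\<forall>v\<in>tm_vars t. bs ! g v = e v \<Longrightarrow> Inum bs (mir_num t g) = tm_val e t"
  by (induction t) auto

lemma one_rdvd_iff: "1 rdvd x \<longleftrightarrow> x \<in> \<int>"
  by (auto simp: rdvd_def Ints_def)

text \<open>Only the free variables are required to match, because \<open>g\<close> may send other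
  names to indices outside \<open>bs\<close>. Under a quantifier the list, the map and the
  environment all change, so the induction generalizes over the three.\<close>

lemma Ifm_mir_fm:
  "\<forall>v\<in>free_vars \<phi>. bs ! g v = e v \<Longrightarrow> Ifm bs (mir_fm \<phi> g) \<longleftrightarrow> sat e \<phi>"
proof (induction \<phi> arbitrary: bs g e)
  case (Exists v \<phi>)
  have "Ifm (r # bs) (mir_fm \<phi> (\<lambda>u. if u = v then 0 else Suc (g u))) \<longleftrightarrow> sat (e(v := r)) \<phi>" for r
    by (rule Exists.IH) (use Exists.prems in auto)
  then show ?case by simp
next
  case (Forall v \<phi>)
  have "Ifm (r # bs) (mir_fm \<phi> (\<lambda>u. if u = v then 0 else Suc (g u))) \<longleftrightarrow> sat (e(v := r)) \<phi>" for r
    by (rule Forall.IH) (use Forall.prems in auto)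
  then show ?case by simp
next
  case (Neg \<phi>)
  then show ?case by simp
next
  case (Conj \<phi> \<psi>)
  have "Ifm bs (mir_fm \<phi> g) \<longleftrightarrow> sat e \<phi>" "Ifm bs (mir_fm \<psi> g) \<longleftrightarrow> sat e \<psi>"
    by (rule Conj.IH; use Conj.prems in simp)+
  then show ?case by simp
next
  case (Disj \<phi> \<psi>)
  have "Ifm bs (mir_fm \<phi> g) \<longleftrightarrow> sat e \<phi>" "Ifm bs (mir_fm \<psi> g) \<longleftrightarrow> sat e \<psi>"
    by (rule Disj.IH; use Disj.prems in simp)+
  then show ?case by simp
next
  case (Impl \<phi> \<psi>)
  have "Ifm bs (mir_fm \<phi> g) \<longleftrightarrow> sat e \<phi>" "Ifm bs (mir_fm \<psi> g) \<longleftrightarrow> sat e \<psi>"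
    by (rule Impl.IH; use Impl.prems in simp)+
  then show ?case by simp
next
  case (Equal s t)
  then show ?case using Inum_mir_num[of s bs g e] Inum_mir_num[of t bs g e] by (simp add: ball_Un)
next
  case (Leq s t)
  then show ?case using Inum_mir_num[of s bs g e] Inum_mir_num[of t bs g e] by (simp add: ball_Un)
next
  case (IsInt t)
  then show ?case using Inum_mir_num[of t bs g e] by (simp add: one_rdvd_iff)
qed

subsection \<open>Splitting predicates into conditions on fractional and integer parts\<close>

text \<open>Generated without negation so that a disjunctive normal form can be read off directly;
  \<open>split_pred_not\<close> recovers complements. Strictness matters only for fractional parts,
  since over the integers \<open>t < 0\<close> is \<open>t + 1 \<le> 0\<close>.\<close>

inductive split_pred :: "nat \<Rightarrow> ((nat \<Rightarrow> real) \<Rightarrow> bool) \<Rightarrow> bool" for n where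
  frac_le: "split_pred n (\<lambda>x. lin n a (\<lambda>i. frac (x i)) + of_int b \<le> 0)"
| frac_lt: "split_pred n (\<lambda>x. lin n a (\<lambda>i. frac (x i)) + of_int b < 0)"
| int_le: "split_pred n (\<lambda>x. lin n a (\<lambda>i. \<lfloor>x i\<rfloor>) + b \<le> 0)"
| int_dvd: "d > 0 \<Longrightarrow> split_pred n (\<lambda>x. d dvd lin n a (\<lambda>i. \<lfloor>x i\<rfloor>) + b)"
| conj: "split_pred n P \<Longrightarrow> split_pred n Q \<Longrightarrow> split_pred n (\<lambda>x. P x \<and> Q x)"
| disj: "split_pred n P \<Longrightarrow> split_pred n Q \<Longrightarrow> split_pred n (\<lambda>x. P x \<or> Q x)"

lemma split_pred_const: "split_pred n (\<lambda>_. b)"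
proof (cases b)
  case True
  then show ?thesis using int_le[of n "\<lambda>_. 0" 0] by (simp add: lin_coeff_simps)
next
  case False
  then show ?thesis using int_le[of n "\<lambda>_. 0" 1] by (simp add: lin_coeff_simps)
qed

lemma split_pred_bex:
  assumes "finite I" "\<And>i. i \<in> I \<Longrightarrow> split_pred n (P i)"
  shows "split_pred n (\<lambda>x. \<exists>i\<in>I. P i x)"
  using assms by (induction I rule: finite_induct) (auto intro: split_pred_const disj)

text \<open>The complement of one residue class is the finite union of the others with the same
  modulus, so indivisibility stays within the positive fragment.\<close>

lemma not_dvd_iff_ex_dvd_add:
  fixes d t :: int
  assumes "d > 0"
  shows "\<not> d dvd t \<longleftrightarrow> (\<exists>r\<in>{1..<d}. d dvd t + r)"
proof
  assume nd: "\<not> d dvd t"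
  have "d dvd t + (d - t mod d)"
    by (metis add_diff_eq diff_add_eq dvd_add_triv_right_iff dvd_minus_mod)
  moreover have "0 \<le> t mod d" "t mod d < d" "t mod d \<noteq> 0"
    using assms nd by (auto simp: dvd_eq_mod_eq_0)
  ultimately show "\<exists>r\<in>{1..<d}. d dvd t + r"
    by (intro bexI[of _ "d - t mod d"]) auto
next
  assume "\<exists>r\<in>{1..<d}. d dvd t + r"
  then obtain r where r: "1 \<le> r" "r < d" "d dvd t + r" by auto
  show "\<not> d dvd t"
  proof
    assume "d dvd t"
    then have "d dvd r" using r(3) by (simp add: dvd_add_right_iff)
    then show False using r zdvd_imp_le by fastforce
  qed
qed

lemma split_pred_not: "split_pred n P \<Longrightarrow> split_pred n (\<lambda>x. \<not> P x)"
proof (induction rule: split_pred.induct)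
  case (frac_le a b)
  have "(\<lambda>x. \<not> lin n a (\<lambda>i. frac (x i :: real)) + of_int b \<le> 0) =
        (\<lambda>x. lin n (\<lambda>i. - a i) (\<lambda>i. frac (x i)) + of_int (- b) < 0)"
    by (auto simp: lin_coeff_simps)
  then show ?case using split_pred.frac_lt by metis
next
  case (frac_lt a b)
  have "(\<lambda>x. \<not> lin n a (\<lambda>i. frac (x i :: real)) + of_int b < 0) =
        (\<lambda>x. lin n (\<lambda>i. - a i) (\<lambda>i. frac (x i)) + of_int (- b) \<le> 0)"
    by (auto simp: lin_coeff_simps)
  then show ?case using split_pred.frac_le by metis
next
  case (int_le a b)
  \<comment> \<open>Over the integers the complement of \<open>t \<le> 0\<close> is
    \<open>1 - t \<le> 0\<close>, which explains the constant \<open>1 - b\<close>.\<close>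
  have "(\<lambda>x. \<not> lin n a (\<lambda>i. \<lfloor>x i :: real\<rfloor>) + b \<le> 0) =
        (\<lambda>x. lin n (\<lambda>i. - a i) (\<lambda>i. \<lfloor>x i\<rfloor>) + (1 - b) \<le> 0)"
    by (auto simp: lin_coeff_simps)
  then show ?case using split_pred.int_le by metis
next
  case (int_dvd d a b)
  have "split_pred n (\<lambda>x. \<exists>r\<in>{1..<d}. d dvd lin n a (\<lambda>i. \<lfloor>x i\<rfloor>) + (b + r))"
    by (intro split_pred_bex split_pred.int_dvd int_dvd) simp
  then show ?case by (simp add: not_dvd_iff_ex_dvd_add[OF int_dvd] add.assoc)
next
  case (conj P Q)
  then show ?case using split_pred.disj by (simp only: de_Morgan_conj)
next
  case (disj P Q)
  then show ?case using split_pred.conj by (simp only: de_Morgan_disj)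
qed

lemma split_pred_imp:
  "split_pred n P \<Longrightarrow> split_pred n Q \<Longrightarrow> split_pred n (\<lambda>x. P x \<longrightarrow> Q x)"
  unfolding imp_conv_disj by (intro disj split_pred_not)

lemma split_pred_iff:
  "split_pred n P \<Longrightarrow> split_pred n Q \<Longrightarrow> split_pred n (\<lambda>x. P x \<longleftrightarrow> Q x)"
  unfolding iff_conv_conj_imp by (intro conj split_pred_imp)

section \<open>Functions piecewise affine in floors and fractional parts\<close>

text \<open>The guards only have to cover; on overlaps the formulas agree since each computes
  \<open>f\<close>. The coefficients \<open>a\<close> and \<open>c\<close> are kept apart because
  taking a floor preserves the former and absorbs the latter into the guards.\<close>

definition split_pieces ::
  "nat \<Rightarrow> ((nat \<Rightarrow> real) \<Rightarrow> real) \<Rightarrow>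
    (((nat \<Rightarrow> real) \<Rightarrow> bool) \<times> (nat \<Rightarrow> int) \<times> (nat \<Rightarrow> int) \<times> int) set \<Rightarrow> bool" where
  "split_pieces n f \<P> \<longleftrightarrow> finite \<P> \<and> (\<forall>G a c k. (G, a, c, k) \<in> \<P> \<longrightarrow> split_pred n G) \<and>
    (\<forall>x. \<exists>G a c k. (G, a, c, k) \<in> \<P> \<and> G x) \<and>
    (\<forall>x G a c k. (G, a, c, k) \<in> \<P> \<longrightarrow> G x \<longrightarrow>
        f x = of_int (lin n a (\<lambda>i. \<lfloor>x i\<rfloor>)) + lin n c (\<lambda>i. frac (x i)) + of_int k)"

lemma split_piecesD:
  assumes "split_pieces n f \<P>"
  shows "finite \<P>" "(G, a, c, k) \<in> \<P> \<Longrightarrow> split_pred n G"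
    "\<exists>G a c k. (G, a, c, k) \<in> \<P> \<and> G x"
    "(G, a, c, k) \<in> \<P> \<Longrightarrow> G x \<Longrightarrow>
       f x = of_int (lin n a (\<lambda>i. \<lfloor>x i\<rfloor>)) + lin n c (\<lambda>i. frac (x i)) + of_int k"
  using assms unfolding split_pieces_def by blast+

definition split_fun :: "nat \<Rightarrow> ((nat \<Rightarrow> real) \<Rightarrow> real) \<Rightarrow> bool" where
  "split_fun n f \<longleftrightarrow> (\<exists>\<P>. split_pieces n f \<P>)"

lemma split_funI:
  assumes "finite \<P>" "\<And>G a c k. (G, a, c, k) \<in> \<P> \<Longrightarrow> split_pred n G"
    "\<And>x. \<exists>G a c k. (G, a, c, k) \<in> \<P> \<and> G x"
    "\<And>x G a c k. (G, a, c, k) \<in> \<P> \<Longrightarrow> G x \<Longrightarrow>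
       f x = of_int (lin n a (\<lambda>i. \<lfloor>x i\<rfloor>)) + lin n c (\<lambda>i. frac (x i)) + of_int k"
  shows "split_fun n f"
  unfolding split_fun_def split_pieces_def using assms by (intro exI[of _ \<P>] conjI allI impI) blast+

lemma split_fun_const: "split_fun n (\<lambda>_. of_int c)"
  by (rule split_funI[of "{(\<lambda>_. True, \<lambda>_. 0, \<lambda>_. 0, c)}"]) (auto simp: split_pred_const lin_coeff_simps)

lemma split_fun_coord:
  assumes "m < n"
  shows "split_fun n (\<lambda>x. x m)"
  by (rule split_funI[of "{(\<lambda>_. True, \<lambda>i. if i = m then 1 else 0, \<lambda>i. if i = m then 1 else 0, 0)}"])
     (auto simp: split_pred_const lin_unit[OF assms] frac_def)

lemma split_fun_add:
  assumes "split_fun n f" "split_fun n g"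
  shows "split_fun n (\<lambda>x. f x + g x)"
proof -
  obtain \<P> where P: "split_pieces n f \<P>"
    using assms(1) unfolding split_fun_def by blast
  note P = split_piecesD[OF P]
  obtain \<Q> where Q: "split_pieces n g \<Q>"
    using assms(2) unfolding split_fun_def by blast
  note Q = split_piecesD[OF Q]
  let ?h = "\<lambda>((G, a, c, k), (G', a', c', k')).
    (\<lambda>x :: nat \<Rightarrow> real. G x \<and> G' x, \<lambda>i. a i + a' i :: int, \<lambda>i. c i + c' i :: int, k + k' :: int)"
  show ?thesis
  proof (rule split_funI[of "?h ` (\<P> \<times> \<Q>)"])
    show "finite (?h ` (\<P> \<times> \<Q>))" using P(1) Q(1) by simp
    show "split_pred n G" if "(G, a, c, k) \<in> ?h ` (\<P> \<times> \<Q>)" for G a c k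
      using that by (auto intro!: conj intro: P(2) Q(2))
  next
    fix x
    obtain G a c k G' a' c' k' where pq: "(G, a, c, k) \<in> \<P>" "G x" "(G', a', c', k') \<in> \<Q>" "G' x"
      using P(3)[of x] Q(3)[of x] by blast
    have "?h ((G, a, c, k), (G', a', c', k')) \<in> ?h ` (\<P> \<times> \<Q>)"
      by (rule imageI) (simp add: pq)
    then have "(\<lambda>x. G x \<and> G' x, \<lambda>i. a i + a' i, \<lambda>i. c i + c' i, k + k') \<in> ?h ` (\<P> \<times> \<Q>)"
      by (simp only: prod.case)
    then show "\<exists>G a c k. (G, a, c, k) \<in> ?h ` (\<P> \<times> \<Q>) \<and> G x"
      by (intro exI conjI) (assumption, simp add: pq)
  next
    fix x G a c k
    assume "(G, a, c, k) \<in> ?h ` (\<P> \<times> \<Q>)" "G x"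
    then show "f x + g x = of_int (lin n a (\<lambda>i. \<lfloor>x i\<rfloor>)) + lin n c (\<lambda>i. frac (x i)) + of_int k"
      by (auto simp: lin_coeff_simps P(4) Q(4))
  qed
qed

lemma split_fun_mult:
  assumes "split_fun n f"
  shows "split_fun n (\<lambda>x. of_int t * f x)"
proof -
  obtain \<P> where P: "split_pieces n f \<P>"
    using assms unfolding split_fun_def by blast
  note P = split_piecesD[OF P]
  let ?h = "\<lambda>(G :: (nat \<Rightarrow> real) \<Rightarrow> bool, a, c, k). (G, \<lambda>i. t * a i, \<lambda>i. t * c i, t * k)"
  show ?thesis
  proof (rule split_funI[of "?h ` \<P>"])
    show "finite (?h ` \<P>)" using P(1) by simp
    show "split_pred n G" if "(G, a, c, k) \<in> ?h ` \<P>" for G a c k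
      using that by (auto intro: P(2))
    show "\<exists>G a c k. (G, a, c, k) \<in> ?h ` \<P> \<and> G x" for x
      using P(3)[of x] by force
  next
    fix x G a c k
    assume "(G, a, c, k) \<in> ?h ` \<P>" "G x"
    then show "of_int t * f x = of_int (lin n a (\<lambda>i. \<lfloor>x i\<rfloor>)) + lin n c (\<lambda>i. frac (x i)) + of_int k"
      by (auto simp: lin_coeff_simps P(4) algebra_simps)
  qed
qed

lemma split_fun_uminus: "split_fun n f \<Longrightarrow> split_fun n (\<lambda>x. - f x)"
  using split_fun_mult[of n f "-1"] by simp

lemma split_fun_diff: "split_fun n f \<Longrightarrow> split_fun n g \<Longrightarrow> split_fun n (\<lambda>x. f x - g x)"
  using split_fun_add[OF _ split_fun_uminus, of n f g] by simp

text \<open>On the cube the fractional contribution is bounded, so its floor takes finitely many values.\<close>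

definition floor_pieces ::
  "nat \<Rightarrow> ((nat \<Rightarrow> real) \<Rightarrow> real) \<Rightarrow> (((nat \<Rightarrow> real) \<Rightarrow> bool) \<times> (nat \<Rightarrow> int) \<times> int) set \<Rightarrow> bool" where
  "floor_pieces n f \<P> \<longleftrightarrow> finite \<P> \<and> (\<forall>G a j. (G, a, j) \<in> \<P> \<longrightarrow> split_pred n G) \<and>
    (\<forall>x. \<exists>G a j. (G, a, j) \<in> \<P> \<and> G x) \<and>
    (\<forall>x G a j. (G, a, j) \<in> \<P> \<longrightarrow> G x \<longrightarrow> \<lfloor>f x\<rfloor> = lin n a (\<lambda>i. \<lfloor>x i\<rfloor>) + j)"

lemma floor_piecesD:
  assumes "floor_pieces n f \<P>"
  shows "finite \<P>" "(G, a, j) \<in> \<P> \<Longrightarrow> split_pred n G"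
    "\<exists>G a j. (G, a, j) \<in> \<P> \<and> G x"
    "(G, a, j) \<in> \<P> \<Longrightarrow> G x \<Longrightarrow> \<lfloor>f x\<rfloor> = lin n a (\<lambda>i. \<lfloor>x i\<rfloor>) + j"
  using assms unfolding floor_pieces_def by blast+

text \<open>On a piece, \<open>f x\<close> is an integer plus
  \<open>v = lin n c (frac parts) + k\<close>, so its floor is that integer combination plus the
  floor of \<open>v\<close>. The bound on \<open>v\<close> leaves finitely many candidates
  \<open>j\<close>, and each piece is refined according to \<open>j\<close>.\<close>

lemma ex_floor_pieces:
  assumes "split_fun n f"
  shows "\<exists>\<P>. floor_pieces n f \<P>"
proof -
  obtain \<P> where P: "split_pieces n f \<P>"
    using assms unfolding split_fun_def by blast
  note P = split_piecesD[OF P]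
  define bnd where "bnd c k = (\<Sum>i<n. \<bar>c i\<bar>) + \<bar>k\<bar>" for c :: "nat \<Rightarrow> int" and k
  \<comment> \<open>The two added guards state \<open>j \<le> v\<close> and
    \<open>v < j + 1\<close>, that is, that \<open>j\<close> is the floor of the fractional
    contribution.\<close>
  let ?h = "\<lambda>((G, a, c, k), j).
    (\<lambda>x :: nat \<Rightarrow> real. G x \<and> lin n (\<lambda>i. - c i) (\<lambda>i. frac (x i)) + of_int (j - k) \<le> 0 \<and>
       lin n c (\<lambda>i. frac (x i)) + of_int (k - j - 1) < 0, a, j)"
  let ?D = "SIGMA p:\<P>. {- bnd (fst (snd (snd p))) (snd (snd (snd p)))..
                         bnd (fst (snd (snd p))) (snd (snd (snd p)))}"
  have "floor_pieces n f (?h ` ?D)"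
    unfolding floor_pieces_def
  proof (intro conjI allI impI)
    show "finite (?h ` ?D)" using P(1) by simp
    show "split_pred n G" if "(G, a, j) \<in> ?h ` ?D" for G a j
      using that by (auto simp del: of_int_diff intro!: conj frac_le frac_lt intro: P(2))
  next
    fix x
    obtain G a c k where p: "(G, a, c, k) \<in> \<P>" "G x"
      using P(3)[of x] by auto
    define v where "v = lin n c (\<lambda>i. frac (x i)) + of_int k"
    have "\<bar>v\<bar> \<le> of_int (bnd c k)"
      using abs_lin_frac_le[of n c x] unfolding v_def bnd_def by simp
    then have "- bnd c k \<le> \<lfloor>v\<rfloor>" "\<lfloor>v\<rfloor> \<le> bnd c k" by linarith+
    then have "?h ((G, a, c, k), \<lfloor>v\<rfloor>) \<in> ?h ` ?D"
      by (intro imageI) (simp add: p)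
    then have "(\<lambda>x. G x \<and> lin n (\<lambda>i. - c i) (\<lambda>i. frac (x i)) + of_int (\<lfloor>v\<rfloor> - k) \<le> 0 \<and>
       lin n c (\<lambda>i. frac (x i)) + of_int (k - \<lfloor>v\<rfloor> - 1) < 0, a, \<lfloor>v\<rfloor>) \<in> ?h ` ?D"
      by (simp only: prod.case)
    note mem = this
    have "of_int \<lfloor>v\<rfloor> \<le> v" "v < of_int \<lfloor>v\<rfloor> + 1" by linarith+
    moreover have "lin n c (\<lambda>i. frac (x i)) = v - of_int k"
      by (simp add: v_def)
    ultimately have "lin n (\<lambda>i. - c i) (\<lambda>i. frac (x i)) + of_int (\<lfloor>v\<rfloor> - k) \<le> 0"
      "lin n c (\<lambda>i. frac (x i)) + of_int (k - \<lfloor>v\<rfloor> - 1) < 0"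
      by (simp_all only: lin_coeff_simps of_int_diff of_int_1)
    with p(2) have "G x \<and> lin n (\<lambda>i. - c i) (\<lambda>i. frac (x i)) + of_int (\<lfloor>v\<rfloor> - k) \<le> 0 \<and>
       lin n c (\<lambda>i. frac (x i)) + of_int (k - \<lfloor>v\<rfloor> - 1) < 0" by blast
    with mem show "\<exists>G a j. (G, a, j) \<in> ?h ` ?D \<and> G x"
      by (intro exI conjI)
  next
    fix x G' a j
    assume "(G', a, j) \<in> ?h ` ?D" "G' x"
    then obtain G c k where *: "(G, a, c :: nat \<Rightarrow> int, k) \<in> \<P>" "G x"
        "lin n (\<lambda>i. - c i) (\<lambda>i. frac (x i)) + of_int (j - k) \<le> 0"
        "lin n c (\<lambda>i. frac (x i)) + of_int (k - j - 1) < 0"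
      by auto
    then show "\<lfloor>f x\<rfloor> = lin n a (\<lambda>i. \<lfloor>x i\<rfloor>) + j"
      by (intro floor_unique) (simp_all add: P(4)[OF *(1,2)] lin_coeff_simps)
  qed
  then show ?thesis by blast
qed

lemma split_fun_floor:
  assumes "split_fun n f"
  shows "split_fun n (\<lambda>x. of_int \<lfloor>f x\<rfloor>)"
proof -
  obtain \<P> where P: "floor_pieces n f \<P>"
    using ex_floor_pieces[OF assms] by blast
  note P = floor_piecesD[OF P]
  let ?h = "\<lambda>(G :: (nat \<Rightarrow> real) \<Rightarrow> bool, a :: nat \<Rightarrow> int, j :: int). (G, a, \<lambda>_ :: nat. 0 :: int, j)"
  show ?thesis
  proof (rule split_funI[of "?h ` \<P>"])
    show "finite (?h ` \<P>)" using P(1) by simp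
    show "split_pred n G" if "(G, a, c, k) \<in> ?h ` \<P>" for G a c k
      using that by (auto intro: P(2))
    show "\<exists>G a c k. (G, a, c, k) \<in> ?h ` \<P> \<and> G x" for x
      using P(3)[of x] by force
  next
    fix x G a c k
    assume "(G, a, c, k) \<in> ?h ` \<P>" "G x"
    then show "of_int \<lfloor>f x\<rfloor> =
        of_int (lin n a (\<lambda>i. \<lfloor>x i\<rfloor>)) + lin n c (\<lambda>i. frac (x i)) + of_int k"
      by (auto simp: lin_coeff_simps P(4))
  qed
qed

text \<open>The common gateway for atoms: after case distinction over the pieces, a test on the
  floor of \<open>f\<close> becomes a test on an integer affine form in the floors of the
  coordinates.\<close>

lemma split_pred_floor:
  assumes "split_fun n f"
    and "\<And>a j. split_pred n (\<lambda>x. R (lin n a (\<lambda>i. \<lfloor>x i\<rfloor>) + j))"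
  shows "split_pred n (\<lambda>x. R \<lfloor>f x\<rfloor>)"
proof -
  obtain \<P> where P: "floor_pieces n f \<P>"
    using ex_floor_pieces[OF assms(1)] by blast
  note P = floor_piecesD[OF P]
  have "split_pred n (\<lambda>x. \<exists>p\<in>\<P>. fst p x \<and> R (lin n (fst (snd p)) (\<lambda>i. \<lfloor>x i\<rfloor>) + snd (snd p)))"
    by (intro split_pred_bex P(1) conj assms(2)) (auto intro: P(2))
  moreover have "R \<lfloor>f x\<rfloor> \<longleftrightarrow>
      (\<exists>p\<in>\<P>. fst p x \<and> R (lin n (fst (snd p)) (\<lambda>i. \<lfloor>x i\<rfloor>) + snd (snd p)))" for x
    proof
    assume "R \<lfloor>f x\<rfloor>"
    moreover obtain G a j where "(G, a, j) \<in> \<P>" "G x"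
      using P(3)[of x] by blast
    ultimately show "\<exists>p\<in>\<P>. fst p x \<and> R (lin n (fst (snd p)) (\<lambda>i. \<lfloor>x i\<rfloor>) + snd (snd p))"
      using P(4) by (intro bexI[of _ "(G, a, j)"]) auto
  next
    assume "\<exists>p\<in>\<P>. fst p x \<and> R (lin n (fst (snd p)) (\<lambda>i. \<lfloor>x i\<rfloor>) + snd (snd p))"
    then show "R \<lfloor>f x\<rfloor>"
      using P(4) by fastforce
  qed
  ultimately show ?thesis by simp
qed

text \<open>A real is negative exactly when its floor is at most -1, so a sign test mixing floors
  and fractional parts reduces to an integer test. The strict case comes first because the other
  comparisons follow from it by negation and conjunction.\<close>

lemma split_pred_less_0:
  assumes "split_fun n f"
  shows "split_pred n (\<lambda>x. f x < 0)"
proof -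
  have "split_pred n (\<lambda>x. \<lfloor>f x\<rfloor> + 1 \<le> 0)"
    using split_pred_floor[OF assms, of "\<lambda>t. t + 1 \<le> 0"] int_le by (simp add: add.assoc)
  moreover have "\<lfloor>f x\<rfloor> + 1 \<le> 0 \<longleftrightarrow> f x < 0" for x by linarith
  ultimately show ?thesis by simp
qed

lemma split_pred_le_0: "split_fun n f \<Longrightarrow> split_pred n (\<lambda>x. f x \<le> 0)"
  using split_pred_not[OF split_pred_less_0[OF split_fun_uminus], of n f] by (simp add: not_less)

lemma split_pred_eq_0:
  assumes "split_fun n f"
  shows "split_pred n (\<lambda>x. f x = 0)"
proof -
  have "split_pred n (\<lambda>x. f x \<le> 0 \<and> - f x \<le> 0)"
    by (intro conj split_pred_le_0 split_fun_uminus assms)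
  moreover have "f x \<le> 0 \<and> - f x \<le> 0 \<longleftrightarrow> f x = 0" for x by linarith
  ultimately show ?thesis by simp
qed

lemma split_pred_rdvd:
  assumes "split_fun n f"
  shows "split_pred n (\<lambda>x. real_of_int d rdvd f x)"
proof (cases "d = 0")
  case True
  then show ?thesis using split_pred_eq_0[OF assms] by (simp add: rdvd_left_0_eq)
next
  case False
  \<comment> \<open>Real divisibility by an integer means that \<open>f x\<close> is an integer and
    that this integer is divisible. The absolute value is taken because \<open>int_dvd\<close>
    demands a positive modulus.\<close>
  have "split_pred n (\<lambda>x. \<bar>d\<bar> dvd \<lfloor>f x\<rfloor> \<and> of_int \<lfloor>f x\<rfloor> - f x = 0)"
    using False by (intro conj split_pred_eq_0 split_fun_diff split_fun_floor assms
        split_pred_floor[OF assms] int_dvd) simp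
  then show ?thesis by (simp add: int_rdvd_real)
qed

section \<open>Quantifier-free formulas over padded environments\<close>

text \<open>Each index becomes harmless once the padding is long enough. Stating this with
  \<open>eventually\<close> combines the bounds of all subterms without ever computing a largest
  index.\<close>

lemma eventually_split_fun_Inum:
  "\<forall>\<^sub>F k in sequentially. split_fun n (\<lambda>x. Inum (map x [0..<n] @ replicate k 0) t)"
proof -
  have nth: "\<forall>\<^sub>F k in sequentially. split_fun n (\<lambda>x. (map x [0..<n] @ replicate k 0) ! m)" for m
    using eventually_gt_at_top[of m]
  proof eventually_elim
    case (elim k)
    show ?case
    proof (cases "m < n")
      case True
      then show ?thesis by (simp add: nth_append split_fun_coord)
    next
      case False
      then show ?thesis using elim split_fun_const[of n 0] by (simp add: nth_append)
    qed
  qed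
  show ?thesis
  proof (induction t)
    case (C c)
    show ?case by (simp add: split_fun_const)
  next
    case (Bound m)
    show ?case using nth[of m] by simp
  next
    case (CN m c t)
    show ?case using nth[of m] CN
      by eventually_elim (simp add: split_fun_add split_fun_mult)
  next
    case (Neg t)
    then show ?case by eventually_elim (simp add: split_fun_uminus)
  next
    case (Add s t)
    then show ?case by eventually_elim (simp add: split_fun_add)
  next
    case (Sub s t)
    then show ?case by eventually_elim (simp add: split_fun_diff)
  next
    case (Mul c t)
    from this show ?case by eventually_elim (simp add: split_fun_mult)
  next
    case (Floor t)
    from this show ?case by eventually_elim (simp add: split_fun_floor)
  next
    case (CF c s t)
    then show ?case by eventually_elim (simp add: split_fun_add split_fun_mult split_fun_floor)
  qed
qed

lemma eventually_split_pred_Ifm: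
  "qfree q \<Longrightarrow> \<forall>\<^sub>F k in sequentially. split_pred n (\<lambda>x. Ifm (map x [0..<n] @ replicate k 0) q)"
proof (induction q)
  case (Lt t)
  show ?case using eventually_split_fun_Inum[of n t]
    by eventually_elim (simp add: split_pred_less_0)
next
  case (Le t)
  show ?case using eventually_split_fun_Inum[of n t]
    by eventually_elim (simp add: split_pred_le_0)
next
  case (Gt t)
  show ?case using eventually_split_fun_Inum[of n t]
    by eventually_elim (simp add: split_pred_not split_pred_le_0 flip: not_le)
next
  case (Ge t)
  show ?case using eventually_split_fun_Inum[of n t]
    by eventually_elim (simp add: split_pred_not split_pred_less_0 flip: not_less)
next
  case (Eq t)
  show ?case using eventually_split_fun_Inum[of n t]
    by eventually_elim (simp add: split_pred_eq_0)
next
  case (NEq t)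
  show ?case using eventually_split_fun_Inum[of n t]
    by eventually_elim (simp add: split_pred_eq_0 split_pred_not)
next
  case (Dvd d t)
  show ?case using eventually_split_fun_Inum[of n t]
    by eventually_elim (simp add: split_pred_rdvd)
next
  case (NDvd d t)
  show ?case using eventually_split_fun_Inum[of n t]
    by eventually_elim (simp add: split_pred_rdvd split_pred_not)
next
  case (Not p)
  then have "\<forall>\<^sub>F k in sequentially. split_pred n (\<lambda>x. Ifm (map x [0..<n] @ replicate k 0) p)" by simp
  then show ?case by eventually_elim (simp add: split_pred_not)
next
  case (And p q)
  then have "\<forall>\<^sub>F k in sequentially. split_pred n (\<lambda>x. Ifm (map x [0..<n] @ replicate k 0) p)"
    "\<forall>\<^sub>F k in sequentially. split_pred n (\<lambda>x. Ifm (map x [0..<n] @ replicate k 0) q)" by simp_all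
  then show ?case by eventually_elim (simp add: conj)
next
  case (Or p q)
  then have "\<forall>\<^sub>F k in sequentially. split_pred n (\<lambda>x. Ifm (map x [0..<n] @ replicate k 0) p)"
    "\<forall>\<^sub>F k in sequentially. split_pred n (\<lambda>x. Ifm (map x [0..<n] @ replicate k 0) q)" by simp_all
  then show ?case by eventually_elim (simp add: disj)
next
  case (Imp p q)
  then have "\<forall>\<^sub>F k in sequentially. split_pred n (\<lambda>x. Ifm (map x [0..<n] @ replicate k 0) p)"
    "\<forall>\<^sub>F k in sequentially. split_pred n (\<lambda>x. Ifm (map x [0..<n] @ replicate k 0) q)" by simp_all
  then show ?case by eventually_elim (simp add: split_pred_imp)
next
  case (Iff p q)
  then have "\<forall>\<^sub>F k in sequentially. split_pred n (\<lambda>x. Ifm (map x [0..<n] @ replicate k 0) p)"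
    "\<forall>\<^sub>F k in sequentially. split_pred n (\<lambda>x. Ifm (map x [0..<n] @ replicate k 0) q)" by simp_all
  then show ?case by eventually_elim (simp add: split_pred_iff)
qed (simp_all add: split_pred_const)

text \<open>Eliminated formulas might mention de Bruijn indices beyond \<open>n\<close>, where \<open>(!)\<close> is
  unspecified; padding the environment with zeros makes them harmless.\<close>

theorem split_pred_sat:
  assumes "free_vars \<phi> \<subseteq> {..<n}"
  shows "split_pred n (\<lambda>x. sat x \<phi>)"
proof -
  define q where "q = mircfrqe (mir_fm \<phi> id)"
  have q: "qfree q" "Ifm bs q = Ifm bs (mir_fm \<phi> id)" for bs
    unfolding q_def by (simp_all add: mircfrqe)
  obtain k where "split_pred n (\<lambda>x. Ifm (map x [0..<n] @ replicate k 0) q)"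
    using eventually_happens[OF eventually_split_pred_Ifm[OF q(1), of n]] by auto
  moreover have "Ifm (map x [0..<n] @ replicate k 0) q \<longleftrightarrow> sat x \<phi>" for x
    unfolding q(2) by (rule Ifm_mir_fm) (use assms in \<open>auto simp: nth_append\<close>)
  ultimately show ?thesis by simp
qed

subsection \<open>Semilinearity of integer systems\<close>

text \<open>Stated for a finite family of functions instead of tuples, so that components and slacks
  can be compared together. When \<open>f\<close> is added, points with a large value of
  \<open>f\<close> are dominated by the old basis; the others lie in finitely many level sets of
  \<open>f\<close>, each with its own basis by induction.\<close>

lemma dickson:
  fixes I :: "('a \<Rightarrow> nat) set"
  assumes "finite I"
  shows "\<exists>B\<subseteq>X. finite B \<and> (\<forall>x\<in>X. \<exists>m\<in>B. \<forall>g\<in>I. g m \<le> g x)"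
  using assms
proof (induction I arbitrary: X rule: finite_induct)
  case empty
  show ?case
  proof (cases "X = {}")
    case False
    then obtain x where "x \<in> X" by blast
    then show ?thesis by (intro exI[of _ "{x}"]) auto
  qed auto
next
  case (insert f I)
  obtain B where B: "B \<subseteq> X" "finite B" "\<forall>x\<in>X. \<exists>m\<in>B. \<forall>g\<in>I. g m \<le> g x"
    using insert.IH[of X] by blast
  have "\<forall>v. \<exists>D\<subseteq>{x\<in>X. f x = v}. finite D \<and> (\<forall>x\<in>{x\<in>X. f x = v}. \<exists>m\<in>D. \<forall>g\<in>I. g m \<le> g x)"
    using insert.IH by blast
  then obtain D where "\<forall>v. D v \<subseteq> {x\<in>X. f x = v} \<and> finite (D v) \<and>
      (\<forall>x\<in>{x\<in>X. f x = v}. \<exists>m\<in>D v. \<forall>g\<in>I. g m \<le> g x)"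
    unfolding choice_iff by blast
  then have D: "\<And>v. D v \<subseteq> {x\<in>X. f x = v}" "\<And>v. finite (D v)"
    "\<And>v x. x \<in> X \<Longrightarrow> f x = v \<Longrightarrow> \<exists>m\<in>D v. \<forall>g\<in>I. g m \<le> g x"
    by simp_all
  \<comment> \<open>If \<open>B\<close> is empty then so is \<open>X\<close>, and the unspecified
    value of \<open>Max {}\<close> does no harm.\<close>
  define N where "N = Max (f ` B)"
  have N: "f m \<le> N" if "m \<in> B" for m
    unfolding N_def using B(2) that by simp
  have "\<exists>m\<in>B \<union> \<Union> (D ` {..N}). \<forall>g\<in>insert f I. g m \<le> g x" if x: "x \<in> X" for x
  proof (cases "N \<le> f x")
    case True
    obtain m where "m \<in> B" "\<forall>g\<in>I. g m \<le> g x" using B(3) x by blast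
    with True N[of m] show ?thesis by (intro bexI[of _ m]) auto
  next
    case False
    obtain m where "m \<in> D (f x)" "\<forall>g\<in>I. g m \<le> g x" using D(3)[OF x] by blast
    with False D(1)[of "f x"] show ?thesis by (intro bexI[of _ m]) auto
  qed
  then show ?case
    using B(1,2) D(1,2) by (intro exI[of _ "B \<union> \<Union> (D ` {..N})"]) blast
qed

section \<open>Integer vectors and the monoids they generate\<close>

definition int_vec :: "nat \<Rightarrow> (nat \<Rightarrow> int) \<Rightarrow> real vec" where
  "int_vec n z = vec n (\<lambda>i. of_int (z i))"

lemma int_vec_simps [simp]:
  "int_vec n z \<in> carrier_vec n" "dim_vec (int_vec n z) = n"
  "i < n \<Longrightarrow> int_vec n z $ i = of_int (z i)"
  by (simp_all add: int_vec_def)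

lemma int_vec_in_int_vecs: "int_vec n z \<in> int_vecs n"
  by (simp add: int_vecs_def)

lemma int_vec_add: "int_vec n (\<lambda>i. y i + z i) = int_vec n y + int_vec n z"
  by (rule eq_vecI) simp_all

lemma zero_in_vec_star: "0\<^sub>v n \<in> vec_star n P"
  unfolding vec_star_def by (auto intro: exI[of _ "[]"])

lemma add_in_vec_star: "p \<in> P \<Longrightarrow> m \<in> vec_star n P \<Longrightarrow> p + m \<in> vec_star n P"
  unfolding vec_star_def
proof clarify
  fix ps assume "p \<in> P" "set ps \<subseteq> P"
  then show "\<exists>qs. p + foldr (+) ps (0\<^sub>v n) = foldr (+) qs (0\<^sub>v n) \<and> set qs \<subseteq> P"
    by (intro exI[of _ "p # ps"]) simp
qed

lemma vec_star_induct [consumes 1, case_names zero add]: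
  assumes "m \<in> vec_star n P" "R (0\<^sub>v n)"
    and "\<And>p m. p \<in> P \<Longrightarrow> m \<in> vec_star n P \<Longrightarrow> R m \<Longrightarrow> R (p + m)"
  shows "R m"
proof -
  obtain ps where ps: "m = foldr (+) ps (0\<^sub>v n)" "set ps \<subseteq> P"
    using assms(1) unfolding vec_star_def by blast
  have "set ps \<subseteq> P \<Longrightarrow> foldr (+) ps (0\<^sub>v n) \<in> vec_star n P \<and> R (foldr (+) ps (0\<^sub>v n))"
    by (induction ps) (auto intro: assms zero_in_vec_star add_in_vec_star)
  with ps show ?thesis by simp
qed

section \<open>Systems of integer inequalities and divisibilities\<close>

definition int_system ::
  "nat \<Rightarrow> ((nat \<Rightarrow> int) \<times> int) set \<Rightarrow> ((nat \<Rightarrow> int) \<times> int \<times> int) set \<Rightarrow> (nat \<Rightarrow> int) set" where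
  "int_system n L D = {z. (\<forall>(a, b)\<in>L. lin n a z + b \<le> 0) \<and> (\<forall>(a, d, b)\<in>D. d dvd lin n a z + b)}"

text \<open>Comparing the slacks as well as the signed components makes Dickson's lemma apply: differences of comparable solutions solve the homogeneous system.\<close>

definition slack_le :: "nat \<Rightarrow> ((nat \<Rightarrow> int) \<times> int) set \<Rightarrow> (nat \<Rightarrow> int) \<Rightarrow> (nat \<Rightarrow> int) \<Rightarrow> bool" where
  "slack_le n L m z \<longleftrightarrow>
    (\<forall>i<n. nat (m i) \<le> nat (z i) \<and> nat (- m i) \<le> nat (- z i)) \<and> (\<forall>(a, b)\<in>L. lin n a z \<le> lin n a m)"

text \<open>Dickson's lemma for positive parts, negative parts and slacks. On solutions
  \<open>- (lin n a z + b)\<close> is nonnegative, so truncation by \<open>nat\<close> loses nothing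
  there, and the offset \<open>b\<close> cancels from the comparison.\<close>

lemma finite_slack_le_basis:
  assumes "finite L" "X \<subseteq> int_system n L D"
  shows "\<exists>B\<subseteq>X. finite B \<and> (\<forall>z\<in>X. \<exists>m\<in>B. slack_le n L m z)"
proof -
  define I where "I = (\<lambda>i z. nat (z i :: int)) ` {..<n} \<union> (\<lambda>i z. nat (- z i)) ` {..<n} \<union>
     (\<lambda>(a, b) z. nat (- (lin n a z + b))) ` L"
  have "finite I" unfolding I_def using assms(1) by simp
  then obtain B where B: "B \<subseteq> X" "finite B" "\<forall>z\<in>X. \<exists>m\<in>B. \<forall>g\<in>I. g m \<le> g z"
    using dickson[of I X] by blast
  have "slack_le n L m z" if "z \<in> X" "m \<in> B" and le: "\<forall>g\<in>I. g m \<le> g z" for m z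
    unfolding slack_le_def
  proof (intro conjI allI impI ballI)
    fix i assume "i < n"
    then have "(\<lambda>z. nat (z i)) \<in> I" "(\<lambda>z. nat (- z i)) \<in> I"
      unfolding I_def by (simp_all add: image_eqI[where x = i])
    from this[THEN bspec[OF le]]
    show "nat (m i) \<le> nat (z i)" "nat (- m i) \<le> nat (- z i)" by simp_all
  next
    fix l assume l: "l \<in> L"
    obtain a b where [simp]: "l = (a, b)" by (cases l)
    have "(\<lambda>z. nat (- (lin n a z + b))) \<in> I" unfolding I_def
      by (intro UnI2 image_eqI[where x = "(a, b)"]) (use l in simp_all)
    from bspec[OF le this] have "nat (- (lin n a m + b)) \<le> nat (- (lin n a z + b))" .
    moreover have "lin n a m + b \<le> 0" "lin n a z + b \<le> 0"
      using that assms(2) B(1) l unfolding int_system_def by auto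
    ultimately show "case l of (a, b) \<Rightarrow> lin n a z \<le> lin n a m" by simp
  qed
  then have "\<forall>z\<in>X. \<exists>m\<in>B. slack_le n L m z"
    using B(3) by meson
  with B(1,2) show ?thesis by blast
qed

lemma slack_le_diff:
  assumes "slack_le n L m z" "m \<in> int_system n L' D" "z \<in> int_system n L'' D"
  shows "(\<lambda>i. z i - m i) \<in> int_system n ((\<lambda>(a, b). (a, 0)) ` L) ((\<lambda>(a, d, b). (a, d, 0)) ` D)"
  unfolding int_system_def
proof (intro CollectI conjI ballI)
  fix l assume "l \<in> (\<lambda>(a, b). (a, 0 :: int)) ` L"
  then show "case l of (a, b) \<Rightarrow> lin n a (\<lambda>i. z i - m i) + b \<le> 0"
    using assms(1) unfolding slack_le_def by (auto simp: lin_arg_simps)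
next
  fix l assume "l \<in> (\<lambda>(a, d, b). (a, d, 0 :: int)) ` D"
  then obtain a d b where l: "(a, d, b) \<in> D" "l = (a, d, 0)" by auto
  then have "d dvd (lin n a z + b) - (lin n a m + b)"
    using assms(2,3) unfolding int_system_def by (intro dvd_diff) auto
  then show "case l of (a, d, b) \<Rightarrow> d dvd lin n a (\<lambda>i. z i - m i) + b"
    by (simp add: l(2) lin_arg_simps)
qed

lemma int_system_add:
  assumes "z \<in> int_system n L D"
    "h \<in> int_system n ((\<lambda>(a, b). (a, 0)) ` L) ((\<lambda>(a, d, b). (a, d, 0)) ` D)"
  shows "(\<lambda>i. z i + h i) \<in> int_system n L D"
proof -
  have "lin n a z + lin n a h + b \<le> 0" if "(a, b) \<in> L" for a b
    using that assms unfolding int_system_def by force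
  moreover have "d dvd lin n a z + lin n a h + b" if "(a, d, b) \<in> D" for a d b
  proof -
    have "d dvd lin n a z + b" "d dvd lin n a h"
      using that assms unfolding int_system_def by force+
    then have "d dvd (lin n a z + b) + lin n a h" by (rule dvd_add)
    then show ?thesis by (simp add: algebra_simps)
  qed
  ultimately show ?thesis
    unfolding int_system_def by (auto simp: lin_arg_simps)
qed

text \<open>A Hilbert basis argument: the generators are a Dickson basis of the nonzero solutions.
  Subtracting a generator below a nonzero solution leaves a solution of strictly smaller l1 norm, so
  the descent ends at zero.\<close>

lemma homogeneous_int_system_fin_gen:
  assumes "finite L" "\<And>a b. (a, b) \<in> L \<Longrightarrow> b = 0" "\<And>a d b. (a, d, b) \<in> D \<Longrightarrow> b = 0"
  shows "fin_gen_monoid n (int_vec n ` int_system n L D)"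
proof -
  have "(\<lambda>(a, b). (a, 0)) ` L = id ` L" "(\<lambda>(a, d, b). (a, d, 0)) ` D = id ` D"
    by (intro image_cong; auto dest: assms(2,3))+
  \<comment> \<open>Homogenizing a homogeneous system changes nothing, so differences of comparable
    solutions and sums stay inside it.\<close>
  then have hom: "(\<lambda>(a, b). (a, 0)) ` L = L" "(\<lambda>(a, d, b). (a, d, 0)) ` D = D" by simp_all
  \<comment> \<open>Zero lies below every solution and would make the basis trivial and the descent
    stationary. Only coordinates below \<open>n\<close> count, as \<open>int_vec\<close> ignores the
    rest.\<close>
  define X where "X = {h \<in> int_system n L D. \<exists>i<n. h i \<noteq> 0}"
  have "X \<subseteq> int_system n L D" unfolding X_def by blast
  then obtain B where B: "B \<subseteq> X" "finite B" "\<forall>h\<in>X. \<exists>m\<in>B. slack_le n L m h"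
    using finite_slack_le_basis[OF assms(1), of X n D] by blast
  have zero: "(\<lambda>_. 0) \<in> int_system n L D"
  proof -
    have "b \<le> 0" if "(a, b) \<in> L" for a b using assms(2)[OF that] by simp
    moreover have "d dvd b" if "(a, d, b) \<in> D" for a d b using assms(3)[OF that] by simp
    ultimately show ?thesis by (auto simp: int_system_def lin_arg_simps)
  qed
  have "int_vec n h \<in> vec_star n (int_vec n ` B)" if "h \<in> int_system n L D" for h
    using that
  proof (induction h rule: measure_induct_rule[where f = "\<lambda>h. \<Sum>i<n. nat \<bar>h i\<bar>"])
    case (less h)
    show ?case
    proof (cases "h \<in> X")
      case False
      then have "\<forall>i<n. h i = 0" using less.prems by (simp add: X_def)
      then have "int_vec n h = 0\<^sub>v n" by (intro eq_vecI) simp_all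
      then show ?thesis by (simp add: zero_in_vec_star)
    next
      case True
      then obtain m where m: "m \<in> B" "slack_le n L m h" using B(3) by blast
      have mX: "m \<in> X" using m B(1) by blast
      let ?h = "\<lambda>i. h i - m i"
      have "?h \<in> int_system n L D"
        using slack_le_diff[OF m(2), of L D L] mX less.prems by (simp add: X_def hom)
      moreover have "(\<Sum>i<n. nat \<bar>?h i\<bar>) < (\<Sum>i<n. nat \<bar>h i\<bar>)"
      proof (rule sum_strict_mono_ex1)
        \<comment> \<open>Comparing both signed parts places \<open>m i\<close> between 0 and
          \<open>h i\<close>, so subtracting it lowers the absolute value by exactly
          \<open>\<bar>m i\<bar>\<close>.\<close>
        have le: "nat (m i) \<le> nat (h i)" "nat (- m i) \<le> nat (- h i)" if "i < n" for i
          using m(2) that unfolding slack_le_def by auto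
        show "\<forall>i\<in>{..<n}. nat \<bar>?h i\<bar> \<le> nat \<bar>h i\<bar>"
        proof
          fix i assume "i \<in> {..<n}"
          then show "nat \<bar>?h i\<bar> \<le> nat \<bar>h i\<bar>" using le[of i] by auto
        qed
        obtain i where "i < n" "m i \<noteq> 0" using mX by (auto simp: X_def)
        then show "\<exists>i\<in>{..<n}. nat \<bar>?h i\<bar> < nat \<bar>h i\<bar>"
          using le[of i] by (intro bexI[of _ i]) auto
      qed simp
      ultimately have "int_vec n ?h \<in> vec_star n (int_vec n ` B)"
        by (intro less.IH)
      then have "int_vec n m + int_vec n ?h \<in> vec_star n (int_vec n ` B)"
        using m(1) by (intro add_in_vec_star) auto
      then show ?thesis by (simp flip: int_vec_add)
    qed
  qed
  moreover have "m \<in> int_vec n ` int_system n L D" if "m \<in> vec_star n (int_vec n ` B)" for m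
    using that
  proof (induction rule: vec_star_induct)
    case zero
    have "0\<^sub>v n = int_vec n (\<lambda>_. 0)" by (rule eq_vecI) simp_all
    with zero show ?case using \<open>(\<lambda>_. 0) \<in> int_system n L D\<close> by blast
  next
    case (add p m)
    then obtain y h where y: "p = int_vec n y" "y \<in> B" and h: "m = int_vec n h" "h \<in> int_system n L D"
      by blast
    have "(\<lambda>i. y i + h i) \<in> int_system n L D"
      by (rule int_system_add) (use y h B(1) in \<open>auto simp: hom X_def\<close>)
    then show ?case unfolding y h int_vec_add[symmetric] by (rule imageI)
  qed
  ultimately have "int_vec n ` int_system n L D = vec_star n (int_vec n ` B)" by blast
  then show ?thesis
    unfolding fin_gen_monoid_def using B(2) int_vec_in_int_vecs
    by (intro exI[of _ "int_vec n ` B"]) auto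
qed

text \<open>Every solution is a basis element below it plus their difference, which solves the
  homogeneous system. Thus one monoid serves all the finitely many base points.\<close>

lemma int_system_semilinear:
  assumes "finite L"
  shows "\<exists>B M. finite B \<and> fin_gen_monoid n M \<and>
    int_vec n ` int_system n L D = {int_vec n b + m | b m. b \<in> B \<and> m \<in> M}"
proof -
  let ?H = "int_system n ((\<lambda>(a, b). (a, 0)) ` L) ((\<lambda>(a, d, b). (a, d, 0)) ` D)"
  obtain B where B: "B \<subseteq> int_system n L D" "finite B"
    "\<forall>z\<in>int_system n L D. \<exists>m\<in>B. slack_le n L m z"
    using finite_slack_le_basis[of L "int_system n L D" n D, OF assms subset_refl] by blast
  have fg: "fin_gen_monoid n (int_vec n ` ?H)"
    by (rule homogeneous_int_system_fin_gen) (use assms in auto)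
  have "int_vec n z \<in> {int_vec n b + m | b m. b \<in> B \<and> m \<in> int_vec n ` ?H}"
    if z: "z \<in> int_system n L D" for z
  proof -
    obtain b where b: "b \<in> B" "slack_le n L b z" using B(3) z by blast
    have "(\<lambda>i. z i - b i) \<in> ?H"
      using slack_le_diff[OF b(2)] b(1) B(1) z by blast
    moreover have "int_vec n z = int_vec n b + int_vec n (\<lambda>i. z i - b i)"
      by (simp flip: int_vec_add)
    ultimately show ?thesis using b(1) by blast
  qed
  moreover have "int_vec n b + int_vec n h \<in> int_vec n ` int_system n L D"
    if "b \<in> B" "h \<in> ?H" for b h
  proof -
    have "(\<lambda>i. b i + h i) \<in> int_system n L D"
      using int_system_add that B(1) by blast
    then show ?thesis unfolding int_vec_add[symmetric] by (rule imageI)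
  qed
  ultimately have "int_vec n ` int_system n L D = {int_vec n b + m | b m. b \<in> B \<and> m \<in> int_vec n ` ?H}"
    by (intro subset_antisym subsetI) auto
  then have "finite B \<and> fin_gen_monoid n (int_vec n ` ?H) \<and>
    int_vec n ` int_system n L D = {int_vec n b + m | b m. b \<in> B \<and> m \<in> int_vec n ` ?H}"
    using B(2) fg by (intro conjI)
  then show ?thesis by (intro exI)
qed

subsection \<open>From split predicates to semi-polinear sets\<close>

definition frac_system :: "nat \<Rightarrow> ((nat \<Rightarrow> int) \<times> bool \<times> int) set \<Rightarrow> (nat \<Rightarrow> real) set" where
  "frac_system n K = {y. \<forall>(a, strict, b)\<in>K.
     if strict then lin n a y + of_int b < 0 else lin n a y + of_int b \<le> 0}"

text \<open>Each disjunct is a product of a condition on the cube and one on the lattice: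
  \<open>K\<close> will become the polyhedral part, and \<open>L\<close> with \<open>D\<close> the
  shifted monoids.\<close>

definition dnf_of ::
  "nat \<Rightarrow> ((nat \<Rightarrow> real) \<Rightarrow> bool) \<Rightarrow>
    (((nat \<Rightarrow> int) \<times> bool \<times> int) set \<times> ((nat \<Rightarrow> int) \<times> int) set \<times>
     ((nat \<Rightarrow> int) \<times> int \<times> int) set) set \<Rightarrow> bool" where
  "dnf_of n P \<F> \<longleftrightarrow> finite \<F> \<and> (\<forall>K L D. (K, L, D) \<in> \<F> \<longrightarrow> finite K \<and> finite L \<and> finite D) \<and>
    (\<forall>x. P x \<longleftrightarrow> (\<exists>K L D. (K, L, D) \<in> \<F> \<and>
       (\<lambda>i. frac (x i :: real)) \<in> frac_system n K \<and> (\<lambda>i. \<lfloor>x i\<rfloor>) \<in> int_system n L D))"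

lemma system_empty [simp]: "frac_system n {} = UNIV" "int_system n {} {} = UNIV"
  by (simp_all add: frac_system_def int_system_def)

lemma system_Un:
  "frac_system n (K \<union> K') = frac_system n K \<inter> frac_system n K'"
  "int_system n (L \<union> L') (D \<union> D') = int_system n L D \<inter> int_system n L' D'"
  by (auto simp: frac_system_def int_system_def ball_Un)

lemma split_pred_dnf: "split_pred n P \<Longrightarrow> \<exists>\<F>. dnf_of n P \<F>"
proof (induction rule: split_pred.induct)
  case (frac_le a b)
  show ?case
    by (rule exI[of _ "{({(a, False, b)}, {}, {})}"]) (simp add: dnf_of_def frac_system_def)
next
  case (frac_lt a b)
  show ?case
    by (rule exI[of _ "{({(a, True, b)}, {}, {})}"]) (simp add: dnf_of_def frac_system_def)
next
  case (int_le a b)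
  show ?case
    by (rule exI[of _ "{({}, {(a, b)}, {})}"]) (simp add: dnf_of_def int_system_def)
next
  case (int_dvd d a b)
  show ?case
    by (rule exI[of _ "{({}, {}, {(a, d, b)})}"]) (simp add: dnf_of_def int_system_def)
next
  case (disj P Q)
  then obtain \<F> \<G> where "dnf_of n P \<F>" "dnf_of n Q \<G>" by blast
  then have "dnf_of n (\<lambda>x. P x \<or> Q x) (\<F> \<union> \<G>)" unfolding dnf_of_def by blast
  then show ?case by blast
next
  case (conj P Q)
  then obtain \<F> \<G> where F: "dnf_of n P \<F>" and G: "dnf_of n Q \<G>" by blast
  let ?h = "\<lambda>((K, L, D), (K', L', D')). (K \<union> K', L \<union> L', D \<union> D')"
  have mem: "(K, L, D) \<in> ?h ` (\<F> \<times> \<G>) \<longleftrightarrow> (\<exists>K1 L1 D1 K2 L2 D2. (K1, L1, D1) \<in> \<F> \<and>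
      (K2, L2, D2) \<in> \<G> \<and> K = K1 \<union> K2 \<and> L = L1 \<union> L2 \<and> D = D1 \<union> D2)" for K L D
    by (auto simp: image_iff Bex_def)
  have "dnf_of n (\<lambda>x. P x \<and> Q x) (?h ` (\<F> \<times> \<G>))"
    unfolding dnf_of_def
  proof (intro conjI allI impI)
    show "finite (?h ` (\<F> \<times> \<G>))" using F G by (simp add: dnf_of_def)
  next
    fix K L D assume "(K, L, D) \<in> ?h ` (\<F> \<times> \<G>)"
    then show "finite K" "finite L" "finite D"
      unfolding mem using F G unfolding dnf_of_def by blast+
  next
    fix x
    have "P x \<longleftrightarrow> (\<exists>K L D. (K, L, D) \<in> \<F> \<and>
       (\<lambda>i. frac (x i)) \<in> frac_system n K \<and> (\<lambda>i. \<lfloor>x i\<rfloor>) \<in> int_system n L D)"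
      using F unfolding dnf_of_def by blast
    moreover have "Q x \<longleftrightarrow> (\<exists>K L D. (K, L, D) \<in> \<G> \<and>
       (\<lambda>i. frac (x i)) \<in> frac_system n K \<and> (\<lambda>i. \<lfloor>x i\<rfloor>) \<in> int_system n L D)"
      using G unfolding dnf_of_def by blast
    moreover have "(\<exists>K L D. (K, L, D) \<in> ?h ` (\<F> \<times> \<G>) \<and>
       (\<lambda>i. frac (x i)) \<in> frac_system n K \<and> (\<lambda>i. \<lfloor>x i\<rfloor>) \<in> int_system n L D) \<longleftrightarrow>
      (\<exists>K1 L1 D1 K2 L2 D2. (K1, L1, D1) \<in> \<F> \<and> (K2, L2, D2) \<in> \<G> \<and>
       (\<lambda>i. frac (x i)) \<in> frac_system n (K1 \<union> K2) \<and>
       (\<lambda>i. \<lfloor>x i\<rfloor>) \<in> int_system n (L1 \<union> L2) (D1 \<union> D2))"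
      unfolding mem by blast
    ultimately show "(P x \<and> Q x) \<longleftrightarrow> (\<exists>K L D. (K, L, D) \<in> ?h ` (\<F> \<times> \<G>) \<and>
       (\<lambda>i. frac (x i)) \<in> frac_system n K \<and> (\<lambda>i. \<lfloor>x i\<rfloor>) \<in> int_system n L D)"
      unfolding system_Un by blast
  qed
  then show ?case by blast
qed

lemma frac_system_cong:
  assumes "\<And>i. i < n \<Longrightarrow> y i = y' i"
  shows "y \<in> frac_system n K \<longleftrightarrow> y' \<in> frac_system n K"
  unfolding frac_system_def using lin_cong[of n y y', OF assms] by simp

lemma int_system_cong:
  assumes "\<And>i. i < n \<Longrightarrow> z i = z' i"
  shows "z \<in> int_system n L D \<longleftrightarrow> z' \<in> int_system n L D"
  unfolding int_system_def using lin_cong[of n z z', OF assms] by simp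

lemma sum_of_rat_indicator:
  fixes i n :: nat and c :: "nat \<Rightarrow> real"
  assumes "i < n"
  shows "(\<Sum>j<n. of_rat (if j = i then 1 else 0) * c j) = c i"
proof -
  have "(\<Sum>j<n. of_rat (if j = i then 1 else 0) * c j) = (\<Sum>j<n. if j = i then c j else 0)"
    by (intro sum.cong) auto
  with assms show ?thesis by simp
qed

lemma polyhedral_convex_frac_system:
  assumes "finite K"
  shows "polyhedral_convex n {c \<in> unit_cube n. (\<lambda>i. c $ i) \<in> frac_system n K}"
proof -
  obtain ks where ks: "set ks = K" using finite_list[OF assms] by blast
  \<comment> \<open>Here constants stand to the left of the comparison with 0, whereas polyhedra
    keep them on the right; hence \<open>- b\<close>. The half-open cube contributes 2n further
    constraints below.\<close>
  define constr :: "(nat \<Rightarrow> int) \<times> bool \<times> int \<Rightarrow> rat vec \<times> cmp \<times> rat" where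
    "constr = (\<lambda>(a, strict, b). (vec n (\<lambda>i. of_int (a i)), if strict then LT else LE, of_int (- b)))"
  define cs where "cs = map constr ks @ map (\<lambda>i. (unit_vec n i, GE, 0)) [0..<n] @
    map (\<lambda>i. (unit_vec n i, LT, 1)) [0..<n]"
  have "(\<Sum>i<n. of_rat (vec n (\<lambda>i. of_int (a i)) $ i) * c i) = lin n a c" for a and c :: "nat \<Rightarrow> real"
    by (simp add: lin_def)
  then have constr: "(case constr k of (a, r, b) \<Rightarrow>
      cmp_rel r (\<Sum>i<n. of_rat (a $ i) * c i) (of_rat b)) \<longleftrightarrow>
    (case k of (a, strict, b) \<Rightarrow>
      if strict then lin n a c + of_int b < 0 else lin n a c + of_int b \<le> 0)"
    for k and c :: "nat \<Rightarrow> real"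
    by (auto simp: constr_def of_rat_minus)
  have carrier: "\<forall>(a, r, b)\<in>set cs. a \<in> carrier_vec n"
    by (auto simp: cs_def constr_def)
  have "(\<forall>(a, r, b)\<in>set cs. cmp_rel r (\<Sum>i<n. of_rat (a $ i) * c $ i) (of_rat b)) \<longleftrightarrow>
      (\<forall>i<n. 0 \<le> c $ i \<and> c $ i < 1) \<and> (\<lambda>i. c $ i) \<in> frac_system n K" for c :: "real vec"
    unfolding cs_def set_append ball_Un set_map ball_simps(9) constr ks frac_system_def
    by (auto simp: sum_of_rat_indicator)
  then have "{c \<in> unit_cube n. (\<lambda>i. c $ i) \<in> frac_system n K} =
    {c \<in> carrier_vec n. \<forall>(a, r, b)\<in>set cs. cmp_rel r (\<Sum>i<n. of_rat (a $ i) * c $ i) (of_rat b)}"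
    by (simp add: unit_cube_def)
  with carrier show ?thesis
    unfolding polyhedral_convex_def by blast
qed

lemma semi_polinear_UN:
  assumes "finite I" "\<And>i. i \<in> I \<Longrightarrow> semi_polinear n (S i)"
  shows "semi_polinear n (\<Union>i\<in>I. S i)"
proof -
  have "\<forall>i\<in>I. \<exists>F. finite F \<and> (\<forall>L\<in>F. polinear n L) \<and> S i = \<Union>F"
    using assms(2) unfolding semi_polinear_def by blast
  then obtain \<F> where "\<forall>i\<in>I. finite (\<F> i) \<and> (\<forall>L\<in>\<F> i. polinear n L) \<and> S i = \<Union>(\<F> i)"
    unfolding bchoice_iff by blast
  with assms(1) show ?thesis
    unfolding semi_polinear_def by (intro exI[of _ "\<Union>i\<in>I. \<F> i"]) auto
qed

lemma polinear_imp_semi_polinear: "polinear n L \<Longrightarrow> semi_polinear n L"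
  unfolding semi_polinear_def by (rule exI[of _ "{L}"]) simp

lemma semi_polinear_empty: "semi_polinear n {}"
  unfolding semi_polinear_def by (rule exI[of _ "{}"]) simp

text \<open>Uniqueness of the splitting of a point into cube part and lattice part; it lets
  conditions on floors and fractional parts be read as independent conditions on the two
  summands.\<close>

lemma floor_frac_cube_add:
  assumes "c \<in> unit_cube n" "i < n"
  shows "\<lfloor>(c + int_vec n z) $ i\<rfloor> = z i" "frac ((c + int_vec n z) $ i) = c $ i"
proof -
  have *: "(c + int_vec n z) $ i = c $ i + of_int (z i)" "0 \<le> c $ i" "c $ i < 1"
    using assms by (auto simp: unit_cube_def)
  then show "\<lfloor>(c + int_vec n z) $ i\<rfloor> = z i"
    by (intro floor_unique) simp_all
  with * show "frac ((c + int_vec n z) $ i) = c $ i"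
    by (simp add: frac_def)
qed

lemma cube_add_int_vec_decomp:
  assumes "x \<in> carrier_vec n"
  shows "x = vec n (\<lambda>i. frac (x $ i)) + int_vec n (\<lambda>i. \<lfloor>x $ i\<rfloor>)"
    "vec n (\<lambda>i. frac (x $ i)) \<in> unit_cube n"
proof -
  show "x = vec n (\<lambda>i. frac (x $ i)) + int_vec n (\<lambda>i. \<lfloor>x $ i\<rfloor>)"
    by (rule eq_vecI) (use assms in \<open>auto simp: frac_def\<close>)
  show "vec n (\<lambda>i. frac (x $ i)) \<in> unit_cube n"
    by (simp add: unit_cube_def frac_lt_1)
qed

lemma semi_polinear_system:
  assumes "finite K" "finite L"
  shows "semi_polinear n {x \<in> carrier_vec n.
    (\<lambda>i. frac (x $ i)) \<in> frac_system n K \<and> (\<lambda>i. \<lfloor>x $ i\<rfloor>) \<in> int_system n L D}" (is "semi_polinear n ?S")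
proof -
  define C where "C = {c \<in> unit_cube n. (\<lambda>i. c $ i) \<in> frac_system n K}"
  obtain B M where B: "finite B" and M: "fin_gen_monoid n M" and
    eq: "int_vec n ` int_system n L D = {int_vec n b + m | b m. b \<in> B \<and> m \<in> M}"
    using int_system_semilinear[OF assms(2), of n D] by blast
  have "?S = {c + y | c y. c \<in> C \<and> y \<in> int_vec n ` int_system n L D}"
  proof (intro subset_antisym subsetI)
    fix x assume x: "x \<in> ?S"
    have "(\<lambda>i. vec n (\<lambda>i. frac (x $ i)) $ i) \<in> frac_system n K \<longleftrightarrow>
        (\<lambda>i. frac (x $ i)) \<in> frac_system n K"
      by (rule frac_system_cong) simp
    then have "vec n (\<lambda>i. frac (x $ i)) \<in> C"
      using x cube_add_int_vec_decomp(2)[of x n] by (simp add: C_def)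
    moreover have "int_vec n (\<lambda>i. \<lfloor>x $ i\<rfloor>) \<in> int_vec n ` int_system n L D"
      using x by simp
    ultimately show "x \<in> {c + y | c y. c \<in> C \<and> y \<in> int_vec n ` int_system n L D}"
      using cube_add_int_vec_decomp(1)[of x n] x by blast
  next
    fix x assume "x \<in> {c + y | c y. c \<in> C \<and> y \<in> int_vec n ` int_system n L D}"
    then obtain c z where x: "x = c + int_vec n z" and c: "c \<in> C" and z: "z \<in> int_system n L D"
      by blast
    have cube: "c \<in> unit_cube n" using c by (simp add: C_def)
    have "(\<lambda>i. frac (x $ i)) \<in> frac_system n K \<longleftrightarrow> (\<lambda>i. c $ i) \<in> frac_system n K"
      unfolding x by (rule frac_system_cong) (rule floor_frac_cube_add(2)[OF cube])
    moreover have "(\<lambda>i. \<lfloor>x $ i\<rfloor>) \<in> int_system n L D \<longleftrightarrow> z \<in> int_system n L D"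
      unfolding x by (rule int_system_cong) (rule floor_frac_cube_add(1)[OF cube])
    moreover have "x \<in> carrier_vec n"
      using cube unfolding x unit_cube_def by simp
    ultimately show "x \<in> ?S" using c z by (simp add: C_def)
  qed
  also have "\<dots> = (\<Union>b\<in>B. {c + (int_vec n b + m) | c m. c \<in> C \<and> m \<in> M})"
    unfolding eq by blast
  finally have S: "?S = (\<Union>b\<in>B. {c + (int_vec n b + m) | c m. c \<in> C \<and> m \<in> M})" .
  show ?thesis
  \<comment> \<open>A polinear set requires a nonempty polyhedral part, so an inconsistent
    fractional system must be represented by the empty union.\<close>
  proof (cases "C = {}")
    case True
    then show ?thesis unfolding S by (simp add: semi_polinear_empty)
  next
    case False
    have "polyhedral_convex n C"
      unfolding C_def by (rule polyhedral_convex_frac_system[OF assms(1)])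
    moreover have "C \<subseteq> unit_cube n" by (auto simp: C_def)
    ultimately have "polinear n {c + (int_vec n b + m) | c m. c \<in> C \<and> m \<in> M}" for b
      unfolding polinear_def using False M int_vec_in_int_vecs
      by (intro exI[of _ C] exI[of _ "int_vec n b"] exI[of _ M]) simp
    then show ?thesis
      unfolding S by (intro semi_polinear_UN B polinear_imp_semi_polinear)
  qed
qed

theorem split_pred_semi_polinear:
  assumes "split_pred n P"
  shows "semi_polinear n {x \<in> carrier_vec n. P (\<lambda>i. x $ i)}"
proof -
  obtain \<F> where F: "dnf_of n P \<F>" using split_pred_dnf[OF assms] by blast
  define sol where "sol = (\<lambda>(K, L, D). {x \<in> carrier_vec n.
    (\<lambda>i. frac (x $ i)) \<in> frac_system n K \<and> (\<lambda>i. \<lfloor>x $ i\<rfloor>) \<in> int_system n L D})"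
  have "{x \<in> carrier_vec n. P (\<lambda>i. x $ i)} = (\<Union>p\<in>\<F>. sol p)"
  proof (rule Set.set_eqI)
    fix x :: "real vec"
    have "P (\<lambda>i. x $ i) \<longleftrightarrow> (\<exists>K L D. (K, L, D) \<in> \<F> \<and>
      (\<lambda>i. frac (x $ i)) \<in> frac_system n K \<and> (\<lambda>i. \<lfloor>x $ i\<rfloor>) \<in> int_system n L D)"
      using F unfolding dnf_of_def by blast
    then show "x \<in> {x \<in> carrier_vec n. P (\<lambda>i. x $ i)} \<longleftrightarrow> x \<in> (\<Union>p\<in>\<F>. sol p)"
      by (auto simp: sol_def Bex_def)
  qed
  moreover have "semi_polinear n (sol p)" if "p \<in> \<F>" for p
  proof -
    obtain K L D where p: "p = (K, L, D)" by (cases p)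
    have "finite K" "finite L" using F that unfolding dnf_of_def p by blast+
    then show ?thesis unfolding sol_def p prod.case by (rule semi_polinear_system)
  qed
  moreover have "finite \<F>" using F unfolding dnf_of_def by blast
  ultimately show ?thesis by (simp add: semi_polinear_UN)
qed

subsection \<open>From polinear sets to formulas\<close>

text \<open>Phrased over environments instead of vectors so that the arity can grow:
  \<open>N\<close> is always a fresh variable, and \<open>definable_ex\<close> quantifies it
  away.\<close>

definition definable :: "nat \<Rightarrow> ((nat \<Rightarrow> real) \<Rightarrow> bool) \<Rightarrow> bool" where
  "definable N P \<longleftrightarrow> (\<exists>\<phi>. free_vars \<phi> \<subseteq> {..<N} \<and> (\<forall>e. sat e \<phi> \<longleftrightarrow> P e))"

lemma definableI: "free_vars \<phi> \<subseteq> {..<N} \<Longrightarrow> (\<And>e. sat e \<phi> \<longleftrightarrow> P e) \<Longrightarrow> definable N P"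
  unfolding definable_def by blast

lemma definable_not:
  assumes "definable N P"
  shows "definable N (\<lambda>e. \<not> P e)"
proof -
  obtain \<phi> where "free_vars \<phi> \<subseteq> {..<N}" "\<forall>e. sat e \<phi> \<longleftrightarrow> P e"
    using assms unfolding definable_def by blast
  then show ?thesis by (intro definableI[of "Defs.Neg \<phi>"]) simp_all
qed

lemma definable_conj:
  assumes "definable N P" "definable N Q"
  shows "definable N (\<lambda>e. P e \<and> Q e)"
proof -
  obtain \<phi> where "free_vars \<phi> \<subseteq> {..<N}" "\<forall>e. sat e \<phi> \<longleftrightarrow> P e"
    using assms unfolding definable_def by blast
  moreover obtain \<psi> where "free_vars \<psi> \<subseteq> {..<N}" "\<forall>e. sat e \<psi> \<longleftrightarrow> Q e"
    using assms unfolding definable_def by blast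
  ultimately show ?thesis by (intro definableI[of "Conj \<phi> \<psi>"]) simp_all
qed

lemma definable_disj:
  assumes "definable N P" "definable N Q"
  shows "definable N (\<lambda>e. P e \<or> Q e)"
  using definable_not[OF definable_conj[OF definable_not[OF assms(1)] definable_not[OF assms(2)]]]
  by simp

lemma definable_ex:
  assumes "definable (Suc N) P"
  shows "definable N (\<lambda>e. \<exists>r. P (e(N := r)))"
proof -
  obtain \<phi> where "free_vars \<phi> \<subseteq> {..<Suc N}" "\<forall>e. sat e \<phi> \<longleftrightarrow> P e"
    using assms unfolding definable_def by blast
  then show ?thesis by (intro definableI[of "Exists N \<phi>"]) (auto simp: lessThan_Suc)
qed

lemma definable_const: "definable N (\<lambda>_. b)"
proof -
  have "definable N (\<lambda>_. True)"
    \<comment> \<open>There is no truth constant, and for \<open>N = 0\<close> no free variable may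
      occur, so a closed tautology has to bind one.\<close>
    by (rule definableI[of "Exists 0 (Equal (Var 0) (Var 0))"]) auto
  then show ?thesis using definable_not[of N "\<lambda>_. True"] by (cases b) simp_all
qed

lemma definable_ball:
  assumes "finite I" "\<And>i. i \<in> I \<Longrightarrow> definable N (P i)"
  shows "definable N (\<lambda>e. \<forall>i\<in>I. P i e)"
  using assms by (induction I rule: finite_induct) (auto intro: definable_const definable_conj)

lemma definable_bex:
  assumes "finite I" "\<And>i. i \<in> I \<Longrightarrow> definable N (P i)"
  shows "definable N (\<lambda>e. \<exists>i\<in>I. P i e)"
  using assms by (induction I rule: finite_induct) (auto intro: definable_const definable_disj)

section \<open>Sign tests and the constants 0 and 1\<close>

lemma definable_int: "v < N \<Longrightarrow> definable N (\<lambda>e. e v \<in> \<int>)"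
  by (rule definableI[of "IsInt (Var v)"]) auto

text \<open>Without a constant zero, the sign of \<open>v\<close> is read off from comparing
  \<open>v + v\<close> with \<open>v\<close>.\<close>

lemma definable_pos: "v < N \<Longrightarrow> definable N (\<lambda>e. 0 < e v)"
  by (rule definableI[of "Defs.Neg (Leq (Plus (Var v) (Var v)) (Var v))"]) auto

lemma definable_nonneg: "v < N \<Longrightarrow> definable N (\<lambda>e. 0 \<le> e v)"
  by (rule definableI[of "Leq (Var v) (Plus (Var v) (Var v))"]) auto

lemma definable_eq_0: "v < N \<Longrightarrow> definable N (\<lambda>e. e v = 0)"
  by (rule definableI[of "Equal (Plus (Var v) (Var v)) (Var v)"]) auto

text \<open>The least positive integer: a description of 1 that uses only order, sign and
  integrality, hence expressible without constants.\<close>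

lemma real_eq_1_iff: "(x :: real) = 1 \<longleftrightarrow> x \<in> \<int> \<and> 0 < x \<and> \<not> (\<exists>y. y \<in> \<int> \<and> 0 < y \<and> y < x)"
proof
  assume "x = 1"
  then show "x \<in> \<int> \<and> 0 < x \<and> \<not> (\<exists>y. y \<in> \<int> \<and> 0 < y \<and> y < x)"
    by (auto elim!: Ints_cases)
next
  assume x: "x \<in> \<int> \<and> 0 < x \<and> \<not> (\<exists>y. y \<in> \<int> \<and> 0 < y \<and> y < x)"
  then obtain k where k: "x = of_int k" "0 < k" by (auto elim!: Ints_cases)
  have "\<not> 1 < x" using x by auto
  with k show "x = 1" by simp
qed

lemma definable_eq_1:
  assumes "v < N"
  shows "definable N (\<lambda>e. e v = 1)"
proof -
  have less: "definable (Suc N) (\<lambda>e. e N < e v)"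
    by (rule definableI[of "Defs.Neg (Leq (Var v) (Var N))"]) (use assms in auto)
  have "definable N (\<lambda>e. \<exists>y. (e(N := y)) N \<in> \<int> \<and> 0 < (e(N := y)) N \<and> (e(N := y)) N < (e(N := y)) v)"
    by (intro definable_ex definable_conj definable_int definable_pos less) simp_all
  then have "definable N (\<lambda>e. e v \<in> \<int> \<and> 0 < e v \<and>
      \<not> (\<exists>y. (e(N := y)) N \<in> \<int> \<and> 0 < (e(N := y)) N \<and> (e(N := y)) N < (e(N := y)) v))"
    by (intro definable_conj definable_int definable_pos definable_not assms)
  moreover have "(e v \<in> \<int> \<and> 0 < e v \<and>
      \<not> (\<exists>y. (e(N := y)) N \<in> \<int> \<and> 0 < (e(N := y)) N \<and> (e(N := y)) N < (e(N := y)) v)) \<longleftrightarrow> e v = 1"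
    for e :: "nat \<Rightarrow> real"
    unfolding real_eq_1_iff[of "e v"] using assms by simp
  ultimately show ?thesis by simp
qed

text \<open>Terms are nonempty sums of variables, so the empty sum needs a variable \<open>w\<close>
  assumed to hold zero.\<close>

lemma ex_nat_multiple_tm:
  "\<exists>t. tm_vars t \<subseteq> {w, v} \<and> (\<forall>e. e w = 0 \<longrightarrow> tm_val e t = of_nat k * e v)"
proof (induction k)
  case 0
  show ?case by (rule exI[of _ "Var w"]) simp
next
  case (Suc k)
  then obtain t where "tm_vars t \<subseteq> {w, v}" "\<forall>e. e w = 0 \<longrightarrow> tm_val e t = of_nat k * e v" by blast
  then show ?case by (intro exI[of _ "Plus (Var v) t"]) (simp add: algebra_simps)
qed

lemma ex_nat_combination_tm:
  "\<exists>t. tm_vars t \<subseteq> {..<N} \<union> {w} \<and> (\<forall>e. e w = 0 \<longrightarrow> tm_val e t = (\<Sum>i<N. of_nat (k i) * e i))"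
proof (induction N)
  case 0
  show ?case by (rule exI[of _ "Var w"]) simp
next
  case (Suc N)
  then obtain s where s: "tm_vars s \<subseteq> {..<N} \<union> {w}"
    "\<forall>e. e w = 0 \<longrightarrow> tm_val e s = (\<Sum>i<N. of_nat (k i) * e i)" by blast
  obtain t where t: "tm_vars t \<subseteq> {w, N}" "\<forall>e. e w = 0 \<longrightarrow> tm_val e t = of_nat (k N) * e N"
    using ex_nat_multiple_tm[of w N "k N"] by blast
  have "tm_vars (Plus s t) \<subseteq> {..<Suc N} \<union> {w}" using s(1) t(1) by (auto simp: less_Suc_eq)
  then show ?case using s(2) t(2) by (intro exI[of _ "Plus s t"]) simp
qed

section \<open>Rational linear constraints\<close>

text \<open>Negative coefficients move to the other side, leaving natural combinations to be
  compared. The fresh variable \<open>N\<close>, forced to be 0, supplies the missing zero.\<close>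

lemma definable_lin_le_0: "definable N (\<lambda>e. lin N a e \<le> 0)"
proof -
  obtain s where s: "tm_vars s \<subseteq> {..<N} \<union> {N}"
    "\<forall>e. e N = 0 \<longrightarrow> tm_val e s = (\<Sum>i<N. of_nat (nat (a i)) * e i)"
    using ex_nat_combination_tm[of N N "\<lambda>i. nat (a i)"] by blast
  obtain t where t: "tm_vars t \<subseteq> {..<N} \<union> {N}"
    "\<forall>e. e N = 0 \<longrightarrow> tm_val e t = (\<Sum>i<N. of_nat (nat (- a i)) * e i)"
    using ex_nat_combination_tm[of N N "\<lambda>i. nat (- a i)"] by blast
  have fv: "free_vars (Leq s t) \<subseteq> {..<Suc N}" using s(1) t(1) by (auto simp: less_Suc_eq)
  have "definable (Suc N) (\<lambda>e. tm_val e s \<le> tm_val e t)"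
    by (rule definableI[OF fv]) simp
  then have "definable N (\<lambda>e. \<exists>r. (e(N := r)) N = 0 \<and> tm_val (e(N := r)) s \<le> tm_val (e(N := r)) t)"
    by (intro definable_ex definable_conj definable_eq_0) simp_all
  moreover have "(\<exists>r. (e(N := r)) N = 0 \<and> tm_val (e(N := r)) s \<le> tm_val (e(N := r)) t) \<longleftrightarrow> lin N a e \<le> 0"
    for e :: "nat \<Rightarrow> real"
  proof -
    have "lin N a e = (\<Sum>i<N. of_nat (nat (a i)) * e i) - (\<Sum>i<N. of_nat (nat (- a i)) * e i)"
      unfolding lin_def sum_subtractf[symmetric]
    proof (intro sum.cong refl)
      fix i
      have "(of_int (a i) :: real) = of_nat (nat (a i)) - of_nat (nat (- a i))" by simp
      then show "of_int (a i) * e i = of_nat (nat (a i)) * e i - of_nat (nat (- a i)) * e i"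
        by (simp only: left_diff_distrib)
    qed
    moreover have "tm_val (e(N := 0)) s = (\<Sum>i<N. of_nat (nat (a i)) * e i)"
      "tm_val (e(N := 0)) t = (\<Sum>i<N. of_nat (nat (- a i)) * e i)"
      using s(2) t(2) by simp_all
    ultimately show ?thesis by simp
  qed
  ultimately show ?thesis by simp
qed

text \<open>Homogenization: the constant \<open>b\<close> becomes the coefficient of a fresh
  variable forced to be 1.\<close>

lemma definable_affine_le_0: "definable N (\<lambda>e. lin N a e + of_int b \<le> 0)"
proof -
  have "definable N (\<lambda>e. \<exists>r. (e(N := r)) N = 1 \<and> lin (Suc N) (a(N := b)) (e(N := r)) \<le> 0)"
    by (intro definable_ex definable_conj definable_eq_1 definable_lin_le_0) simp
  moreover have "lin (Suc N) (a(N := b)) (e(N := r)) = lin N a e + of_int b * r" for e and r :: real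
    by (simp add: lin_def)
  ultimately show ?thesis by simp
qed

lemma ex_common_denominator:
  assumes "finite I"
  shows "\<exists>d>0. \<forall>i\<in>I. \<exists>k. of_int k = of_int d * (q i :: rat)"
  using assms
proof (induction I rule: finite_induct)
  case empty
  show ?case by (rule exI[of _ 1]) simp
next
  case (insert j I)
  then obtain d where d: "d > 0" "\<forall>i\<in>I. \<exists>k. of_int k = of_int d * q i" by blast
  obtain u v where uv: "quotient_of (q j) = (u, v)" by (cases "quotient_of (q j)")
  have v: "v > 0" "q j = of_int u / of_int v"
    using quotient_of_denom_pos[OF uv] quotient_of_div[OF uv] by blast+
  show ?case
  proof (rule exI[of _ "d * v"], intro conjI ballI)
    show "0 < d * v" using d(1) v(1) by simp
    fix i assume "i \<in> insert j I"
    then consider "i = j" | "i \<in> I" by blast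
    then show "\<exists>k. of_int k = of_int (d * v) * q i"
    proof cases
      case 1
      then show ?thesis using v by (intro exI[of _ "d * u"]) simp
    next
      case 2
      then obtain k where "of_int k = of_int d * q i" using d(2) by blast
      then show ?thesis by (intro exI[of _ "k * v"]) simp
    qed
  qed
qed

lemma definable_rat_le:
  "definable N (\<lambda>e. (\<Sum>i<N. of_rat (q i) * e i) \<le> of_rat w)"
proof -
  \<comment> \<open>Storing \<open>- w\<close> at index \<open>N\<close> lets one common denominator
    clear the coefficients and the constant at once.\<close>
  define p where "p i = (if i < N then q i else - w)" for i
  obtain d where d: "d > 0" "\<forall>i\<in>{..N}. \<exists>k. of_int k = of_int d * p i"
    using ex_common_denominator[of "{..N}" p] by blast
  from d(2) obtain a where a: "\<forall>i\<in>{..N}. of_int (a i) = of_int d * p i"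
    unfolding bchoice_iff by blast
  have a_real: "of_int (a i) = (of_int d * of_rat (p i) :: real)" if "i \<le> N" for i
  proof -
    have "of_rat (of_int (a i)) = (of_rat (of_int d * p i) :: real)" using a that by simp
    then show ?thesis by (simp add: of_rat_mult)
  qed
  have "lin N a e + of_int (a N) \<le> 0 \<longleftrightarrow> (\<Sum>i<N. of_rat (q i) * e i) \<le> of_rat w"
    for e :: "nat \<Rightarrow> real"
  proof -
    have "lin N a e = (\<Sum>i<N. of_int d * (of_rat (q i) * e i))"
      unfolding lin_def by (intro sum.cong) (auto simp: a_real p_def)
    moreover have "of_int (a N) = - (of_int d * of_rat w :: real)"
      using a_real[of N] by (simp add: p_def of_rat_minus)
    ultimately have "lin N a e + of_int (a N) = of_int d * ((\<Sum>i<N. of_rat (q i) * e i) - of_rat w)"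
      by (simp add: sum_distrib_left right_diff_distrib)
    then show ?thesis using d(1) by (simp add: mult_le_0_iff)
  qed
  then show ?thesis using definable_affine_le_0[of N a "a N"] by simp
qed

lemma definable_rat_ge:
  "definable N (\<lambda>e. (\<Sum>i<N. of_rat (q i) * e i) \<ge> of_rat w)"
  using definable_rat_le[of N "\<lambda>i. - q i" "- w"] by (simp add: of_rat_minus sum_negf)

lemma definable_cmp:
  "definable N (\<lambda>e. cmp_rel r (\<Sum>i<N. of_rat (q i) * e i) (of_rat w))"
proof (cases r)
  case LT
  then show ?thesis using definable_not[OF definable_rat_ge[of N w q]] by (simp add: not_le)
next
  case LE
  then show ?thesis using definable_rat_le by simp
next
  case EQ
  then show ?thesis using definable_conj[OF definable_rat_le[of N q w] definable_rat_ge[of N w q]]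
    by (simp add: eq_iff)
next
  case GE
  then show ?thesis using definable_rat_ge by simp
next
  case GT
  then show ?thesis using definable_not[OF definable_rat_le[of N q w]] by (simp add: not_le)
qed

section \<open>Membership in a finitely generated monoid\<close>

lemma vec_star_mono: "P \<subseteq> Q \<Longrightarrow> vec_star n P \<subseteq> vec_star n Q"
  unfolding vec_star_def by blast

lemma vec_star_carrier:
  assumes "P \<subseteq> carrier_vec n" "m \<in> vec_star n P"
  shows "m \<in> carrier_vec n"
  using assms(2) by (induction rule: vec_star_induct) (use assms(1) in auto)

text \<open>By commutativity all copies of \<open>p\<close> can be collected in front; their number
  \<open>k\<close> is what the formula later quantifies over.\<close>

lemma vec_star_insert:
  assumes "p \<in> carrier_vec n" "P \<subseteq> carrier_vec n"
  shows "m \<in> vec_star n (insert p P) \<longleftrightarrow> (\<exists>k. \<exists>m'\<in>vec_star n P. m = of_nat k \<cdot>\<^sub>v p + m')"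
proof
  assume "m \<in> vec_star n (insert p P)"
  then show "\<exists>k. \<exists>m'\<in>vec_star n P. m = of_nat k \<cdot>\<^sub>v p + m'"
  proof (induction rule: vec_star_induct)
    case zero
    show ?case
      by (rule exI[of _ 0], rule bexI[OF _ zero_in_vec_star]) (use assms in auto)
  next
    case (add q m)
    then obtain k m' where m: "m' \<in> vec_star n P" "m = of_nat k \<cdot>\<^sub>v p + m'" by blast
    have m': "m' \<in> carrier_vec n" using vec_star_carrier[OF assms(2) m(1)] .
    consider "q = p" | "q \<in> P" using add.hyps by blast
    then show ?case
    proof cases
      case 1
      have "q + m = of_nat (Suc k) \<cdot>\<^sub>v p + m'"
        unfolding m 1 by (rule eq_vecI) (use assms m' in \<open>auto simp: algebra_simps\<close>)
      then show ?thesis using m(1) by blast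
    next
      case 2
      then have "q + m = of_nat k \<cdot>\<^sub>v p + (q + m')"
        unfolding m by (intro eq_vecI) (use assms m' in auto)
      then show ?thesis using add_in_vec_star[OF 2 m(1)] by blast
    qed
  qed
next
  assume "\<exists>k. \<exists>m'\<in>vec_star n P. m = of_nat k \<cdot>\<^sub>v p + m'"
  then obtain k m' where m: "m' \<in> vec_star n P" "m = of_nat k \<cdot>\<^sub>v p + m'" by blast
  have m': "m' \<in> carrier_vec n" using vec_star_carrier[OF assms(2) m(1)] .
  have "of_nat k \<cdot>\<^sub>v p + m' \<in> vec_star n (insert p P)"
  proof (induction k)
    case 0
    have "of_nat 0 \<cdot>\<^sub>v p + m' = m'" by (rule eq_vecI) (use assms m' in auto)
    then show ?case using m(1) vec_star_mono[of P "insert p P" n] by auto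
  next
    case (Suc k)
    have "of_nat (Suc k) \<cdot>\<^sub>v p + m' = p + (of_nat k \<cdot>\<^sub>v p + m')"
      by (rule eq_vecI) (use assms m' in \<open>auto simp: algebra_simps\<close>)
    then show ?case using add_in_vec_star[OF insertI1 Suc] by simp
  qed
  then show "m \<in> vec_star n (insert p P)" using m(2) by simp
qed

text \<open>The multiplicity of each generator becomes a quantified variable, so the coefficient
  vectors \<open>c j\<close> grow while the generators are consumed.\<close>

lemma definable_ex_vec_star:
  assumes "finite J" "set ps \<subseteq> int_vecs n"
  shows "definable N (\<lambda>e. \<exists>m\<in>vec_star n (set ps). \<forall>j\<in>J.
    cmp_rel (r j) ((\<Sum>i<N. of_rat (c j i) * e i) - (\<Sum>i<n. of_rat (q j i) * m $ i)) (of_rat (w j)))"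
  using assms(2)
proof (induction ps arbitrary: N c)
  case Nil
  have "vec_star n {} = {0\<^sub>v n}" by (auto simp: vec_star_def)
  moreover have "definable N (\<lambda>e. \<forall>j\<in>J. cmp_rel (r j) (\<Sum>i<N. of_rat (c j i) * e i) (of_rat (w j)))"
    by (intro definable_ball assms(1) definable_cmp)
  ultimately show ?case by simp
next
  case (Cons p ps)
  have p: "p \<in> carrier_vec n" "\<And>i. i < n \<Longrightarrow> p $ i = of_rat (of_int \<lfloor>p $ i\<rfloor>)"
    and ps: "set ps \<subseteq> int_vecs n"
    using Cons.prems by (auto simp: int_vecs_def)
  have ps': "set ps \<subseteq> carrier_vec n" using ps by (auto simp: int_vecs_def)
  \<comment> \<open>The value of the \<open>j\<close>-th form on the generator \<open>p\<close>. The
    floor recovers the integral entries of the real vector \<open>p\<close> as rationals, so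
    \<open>- t j\<close> is an admissible coefficient for the new multiplicity variable
    \<open>N\<close>.\<close>
  define t where "t j = (\<Sum>i<n. q j i * of_int \<lfloor>p $ i\<rfloor>)" for j
  define c' where "c' j = (c j)(N := - t j)" for j
  have t: "of_rat (t j) = (\<Sum>i<n. of_rat (q j i) * p $ i)" for j
    unfolding t_def of_rat_sum of_rat_mult by (intro sum.cong refl) (use p(2) in simp)
  have "definable N (\<lambda>e. \<exists>k. (e(N := k)) N \<in> \<int> \<and> 0 \<le> (e(N := k)) N \<and>
    (\<exists>m\<in>vec_star n (set ps). \<forall>j\<in>J. cmp_rel (r j)
      ((\<Sum>i<Suc N. of_rat (c' j i) * (e(N := k)) i) - (\<Sum>i<n. of_rat (q j i) * m $ i)) (of_rat (w j))))"
    by (intro definable_ex definable_conj definable_int definable_nonneg Cons.IH[OF ps]) simp_all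
  moreover have "(\<exists>k. (e(N := k)) N \<in> \<int> \<and> 0 \<le> (e(N := k)) N \<and>
    (\<exists>m\<in>vec_star n (set ps). \<forall>j\<in>J. cmp_rel (r j)
      ((\<Sum>i<Suc N. of_rat (c' j i) * (e(N := k)) i) - (\<Sum>i<n. of_rat (q j i) * m $ i)) (of_rat (w j)))) \<longleftrightarrow>
    (\<exists>m\<in>vec_star n (set (p # ps)). \<forall>j\<in>J.
      cmp_rel (r j) ((\<Sum>i<N. of_rat (c j i) * e i) - (\<Sum>i<n. of_rat (q j i) * m $ i)) (of_rat (w j)))"
    (is "?lhs \<longleftrightarrow> ?rhs") for e
  proof -
    have eq: "(\<Sum>i<Suc N. of_rat (c' j i) * (e(N := of_nat k)) i) - (\<Sum>i<n. of_rat (q j i) * m $ i) =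
      (\<Sum>i<N. of_rat (c j i) * e i) - (\<Sum>i<n. of_rat (q j i) * (of_nat k \<cdot>\<^sub>v p + m) $ i)"
      if "m \<in> vec_star n (set ps)" for j k m
    proof -
      have "m \<in> carrier_vec n" using vec_star_carrier[OF ps' that] .
      then have "(\<Sum>i<n. of_rat (q j i) * (of_nat k \<cdot>\<^sub>v p + m) $ i) =
        (\<Sum>i<n. of_nat k * (of_rat (q j i) * p $ i) + of_rat (q j i) * m $ i)"
        by (intro sum.cong refl) (use p(1) in \<open>simp add: algebra_simps\<close>)
      also have "\<dots> = of_nat k * of_rat (t j) + (\<Sum>i<n. of_rat (q j i) * m $ i)"
        by (simp add: sum.distrib t sum_distrib_left)
      finally show ?thesis by (simp add: c'_def of_rat_minus)
    qed
    have "?lhs \<longleftrightarrow> (\<exists>k::nat. \<exists>m\<in>vec_star n (set ps). \<forall>j\<in>J. cmp_rel (r j)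
      ((\<Sum>i<Suc N. of_rat (c' j i) * (e(N := of_nat k)) i) - (\<Sum>i<n. of_rat (q j i) * m $ i)) (of_rat (w j)))"
      (is "_ \<longleftrightarrow> (\<exists>k::nat. ?Q (of_nat k))")
    proof
      assume ?lhs
      then obtain k where k: "k \<in> \<int>" "0 \<le> k" "?Q k" by auto
      then have "k = of_nat (nat \<lfloor>k\<rfloor>)" by (auto elim!: Ints_cases)
      with k(3) show "\<exists>k::nat. ?Q (of_nat k)" by metis
    next
      assume "\<exists>k::nat. ?Q (of_nat k)"
      then obtain k :: nat where "?Q (of_nat k)" by blast
      then show ?lhs by (intro exI[of _ "of_nat k"]) simp
    qed
    also have "\<dots> \<longleftrightarrow> (\<exists>k::nat. \<exists>m\<in>vec_star n (set ps). \<forall>j\<in>J. cmp_rel (r j)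
      ((\<Sum>i<N. of_rat (c j i) * e i) - (\<Sum>i<n. of_rat (q j i) * (of_nat k \<cdot>\<^sub>v p + m) $ i)) (of_rat (w j)))"
      by (simp only: eq cong: bex_cong)
    also have "\<dots> \<longleftrightarrow> ?rhs"
      unfolding list.set Bex_def vec_star_insert[OF p(1) ps'] by blast
    finally show ?thesis .
  qed
  ultimately show ?case by simp
qed

lemma cmp_rel_diff_iff: "cmp_rel r (u - v) w \<longleftrightarrow> cmp_rel r u (w + v)"
  by (cases r) auto

lemma mixed_linearI:
  assumes "definable n P" "S = {x \<in> carrier_vec n. P (\<lambda>i. x $ i)}"
  shows "mixed_linear n S"
  using assms unfolding mixed_linear_def definable_def by auto

text \<open>A point \<open>x\<close> belongs to the set iff some monoid element \<open>m\<close>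
  puts \<open>x - (b + m)\<close> into \<open>C\<close>. As rational constraints on \<open>x\<close>
  and \<open>m\<close> this is the form treated by \<open>definable_ex_vec_star\<close>.\<close>

lemma polinear_definable:
  assumes "polinear n S"
  shows "\<exists>P. definable n P \<and> S = {x \<in> carrier_vec n. P (\<lambda>i. x $ i)}"
proof -
  obtain C b M where C: "polyhedral_convex n C" and b: "b \<in> int_vecs n" and M: "fin_gen_monoid n M"
    and S: "S = {c + (b + m) | c m. c \<in> C \<and> m \<in> M}"
    using assms unfolding polinear_def by blast
  obtain P where "finite P" and P: "P \<subseteq> int_vecs n" "M = vec_star n P"
    using M unfolding fin_gen_monoid_def by blast
  then obtain ps where ps: "set ps = P" using finite_list by blast
  obtain cs where cs: "C = {c \<in> carrier_vec n. \<forall>(a, r, w) \<in> set cs.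
             cmp_rel r (\<Sum>i<n. of_rat (a $ i) * c $ i) (of_rat w)}"
    using C unfolding polyhedral_convex_def by blast
  have carr: "b \<in> carrier_vec n" "P \<subseteq> carrier_vec n" using b P(1) by (auto simp: int_vecs_def)
  define q where "q j i = fst j $ i" for j :: "rat vec \<times> cmp \<times> rat" and i
  define r where "r j = fst (snd j)" for j :: "rat vec \<times> cmp \<times> rat"
  \<comment> \<open>The contribution of the fixed integer vector \<open>b\<close> is moved into the
    rational right-hand side.\<close>
  define s where "s j = snd (snd j) + (\<Sum>i<n. q j i * of_int \<lfloor>b $ i\<rfloor>)" for j
  have s: "of_rat (s j) = of_rat (snd (snd j)) + (\<Sum>i<n. of_rat (q j i) * b $ i)" for j
    unfolding s_def of_rat_add of_rat_sum of_rat_mult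
    by (intro arg_cong2[of _ _ _ _ "(+)"] sum.cong refl) (use b in \<open>auto simp: int_vecs_def\<close>)
  define Q where "Q e \<longleftrightarrow> (\<exists>m\<in>vec_star n (set ps). \<forall>j\<in>set cs. cmp_rel (r j)
    ((\<Sum>i<n. of_rat (q j i) * e i) - (\<Sum>i<n. of_rat (q j i) * m $ i)) (of_rat (s j)))" for e
  have C_iff: "x - (b + m) \<in> C \<longleftrightarrow> (\<forall>j\<in>set cs. cmp_rel (r j)
    ((\<Sum>i<n. of_rat (q j i) * x $ i) - (\<Sum>i<n. of_rat (q j i) * m $ i)) (of_rat (s j)))"
    if "x \<in> carrier_vec n" "m \<in> carrier_vec n" for x m
  proof -
    have "(\<Sum>i<n. of_rat (q j i) * (x - (b + m)) $ i) =
      (\<Sum>i<n. of_rat (q j i) * x $ i) - (\<Sum>i<n. of_rat (q j i) * m $ i) - (\<Sum>i<n. of_rat (q j i) * b $ i)"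
      for j
      unfolding sum_subtractf[symmetric]
      by (intro sum.cong refl) (use that carr(1) in \<open>simp add: algebra_simps\<close>)
    then have "cmp_rel (r j) (\<Sum>i<n. of_rat (q j i) * (x - (b + m)) $ i) (of_rat (snd (snd j))) \<longleftrightarrow>
      cmp_rel (r j) ((\<Sum>i<n. of_rat (q j i) * x $ i) - (\<Sum>i<n. of_rat (q j i) * m $ i)) (of_rat (s j))"
      for j
      unfolding s by (simp only: cmp_rel_diff_iff)
    moreover have "x - (b + m) \<in> carrier_vec n" using that carr(1) by auto
    ultimately show ?thesis
      unfolding cs by (simp add: case_prod_unfold q_def r_def)
  qed
  have "S = {x \<in> carrier_vec n. Q (\<lambda>i. x $ i)}"
  proof (rule Set.set_eqI)
    fix x
    have M_carr: "m \<in> carrier_vec n" if "m \<in> M" for m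
      using vec_star_carrier[OF carr(2)] that P(2) by blast
    have "x \<in> S \<longleftrightarrow> x \<in> carrier_vec n \<and> (\<exists>m\<in>M. x - (b + m) \<in> C)"
    proof
      assume "x \<in> S"
      then obtain c m where x: "x = c + (b + m)" "c \<in> C" "m \<in> M" unfolding S by blast
      have c: "c \<in> carrier_vec n" using x(2) cs by blast
      have "x - (b + m) = c"
        unfolding x(1) by (rule eq_vecI) (use c carr(1) M_carr[OF x(3)] in auto)
      moreover have "x \<in> carrier_vec n"
        unfolding x(1) using c carr(1) M_carr[OF x(3)] by auto
      ultimately show "x \<in> carrier_vec n \<and> (\<exists>m\<in>M. x - (b + m) \<in> C)" using x(2,3) by auto
    next
      assume "x \<in> carrier_vec n \<and> (\<exists>m\<in>M. x - (b + m) \<in> C)"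
      then obtain m where m: "x \<in> carrier_vec n" "m \<in> M" "x - (b + m) \<in> C" by blast
      have "x = (x - (b + m)) + (b + m)"
        by (rule eq_vecI) (use m(1) carr(1) M_carr[OF m(2)] in auto)
      then show "x \<in> S" unfolding S using m(2,3) by blast
    qed
    also have "\<dots> \<longleftrightarrow> x \<in> carrier_vec n \<and> Q (\<lambda>i. x $ i)"
      unfolding Q_def ps P(2)[symmetric] using C_iff M_carr by blast
    finally show "x \<in> S \<longleftrightarrow> x \<in> {x \<in> carrier_vec n. Q (\<lambda>i. x $ i)}" by simp
  qed
  moreover have "definable n Q"
    unfolding Q_def by (rule definable_ex_vec_star) (use ps P(1) in auto)
  ultimately show ?thesis by blast
qed

theorem semi_polinear_mixed_linear:
  assumes "semi_polinear n S"
  shows "mixed_linear n S"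
proof -
  obtain \<F> where F: "finite \<F>" "\<forall>L\<in>\<F>. polinear n L" "S = \<Union>\<F>"
    using assms unfolding semi_polinear_def by blast
  have "\<forall>L\<in>\<F>. \<exists>P. definable n P \<and> L = {x \<in> carrier_vec n. P (\<lambda>i. x $ i)}"
    using F(2) polinear_definable by blast
  then obtain P where P: "\<forall>L\<in>\<F>. definable n (P L) \<and> L = {x \<in> carrier_vec n. P L (\<lambda>i. x $ i)}"
    unfolding bchoice_iff by blast
  show ?thesis
  proof (rule mixed_linearI)
    show "definable n (\<lambda>e. \<exists>L\<in>\<F>. P L e)"
      using P F(1) by (intro definable_bex) auto
    show "S = {x \<in> carrier_vec n. \<exists>L\<in>\<F>. P L (\<lambda>i. x $ i)}"
      unfolding F(3) using P by blast
  qed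
qed

theorem theorem5p4:
  fixes n :: nat and S :: "real vec set"
  assumes "n \<ge> 1" and "S \<subseteq> carrier_vec n"
  shows "semi_polinear n S \<longleftrightarrow> mixed_linear n S"
proof
  show "semi_polinear n S \<Longrightarrow> mixed_linear n S" by (rule semi_polinear_mixed_linear)
next
  assume "mixed_linear n S"
  then obtain \<phi> where "free_vars \<phi> \<subseteq> {..<n}" "S = {x \<in> carrier_vec n. sat (\<lambda>i. x $ i) \<phi>}"
    unfolding mixed_linear_def by blast
  then show "semi_polinear n S"
    using split_pred_semi_polinear[OF split_pred_sat] by simp
qed

end
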